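(* Let $n\in\mathbb{N}$. Let $\overset{\bullet}{L}(x)$, $x\in\mathbb{R}^n$, be the Lévy white noise, i.e. the formal expansion $$\overset{\bullet}{L}(x)=m_2\sum_{i\ge 1}e_i(x)\,K_{\varepsilon^{(i,1)}}=\sum_{\alpha\in\mathcal{J}}c_\alpha K_\alpha ,$$ with $c_\alpha=m_2e_i(x)$ if $\alpha=\varepsilon^{(i,1)}$ for some $i\ge1$, and $c_\alpha=0$ otherwise. Let $\overset{\bullet}{\widetilde N}(x,z)$, $x\in\mathbb{R}^n$, $z\in\mathbb{R}_0$, be the white noise of the compensated Poisson random measure $\widetilde N(dx,dz)$, i.e. the formal expansion $$\overset{\bullet}{\widetilde N}(x,z)=\sum_{i,j\ge1}e_i(x)\,p_j(z)\,K_{\varepsilon^{(i,j)}} .$$ Then for the expansion of $\overset{\bullet}{L}(x)$ we have $$\sum_{\alpha\in\mathcal{J}}c_\alpha^2\,\alpha!\,(2\mathbb{N})^{-q\alpha}=m_2^2\sum_{i\ge 1}e_i(x)^2\,2^{-q}\,\kappa(i,1)^{-q}<\infty \quad\text{for } q\ge 2,$$ where one uses that $\kappa(i,1)=1+(i-1)i/2\ge i$ and the estimate $\sup_{t\in\mathbb{R}}|\xi_m(t)|=\mathcal{O}(m^{-1/12})$ for the Hermite functions. Therefore $\overset{\bullet}{L}(x)\in(\mathcal{S})^*$ for all $x$. Similarly, $\overset{\bullet}{\widetilde N}(x,z)\in(\mathcal{S})^*$ for all $x,z$.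
   Context: Lévy measure. $\nu$ is a measure on $\mathbb{R}_0:=\mathbb{R}\setminus\{0\}$ with $\int_{\mathbb{R}_0}z^2\,\nu(dz)<\infty$, such that for every $\varepsilon>0$ there is $\lambda>0$ with $\int_{\mathbb{R}_0\setminus(-\varepsilon,\varepsilon)}e^{\lambda|z|}\nu(dz)<\infty$. Put $\rho(dz)=z^2\nu(dz)$ and $m_2=\left(\int_{\mathbb{R}_0}z^2\,\nu(dz)\right)^{1/2}$. Let $\{\eta_m\}_{m\ge0}$ be the orthogonalization of $1,z,z^2,\dots$ in $L^2(\rho)$ (with $\eta_0=1$) and $p_j(z)=\|\eta_{j-1}\|_{L^2(\rho)}^{-1}\,z\,\eta_{j-1}(z)$, $j\ge1$, so $\{p_j\}_{j\ge 1}$ is an orthonormal basis of $L^2(\nu)$ and $z=m_2p_1(z)$. Hermite functions. $h_k(t)=(-1)^k e^{t^2/2}\frac{d^k}{dt^k}e^{-t^2/2}$, $k\ge0$, and $\xi_k(t)=\pi^{-1/4}((k-1)!)^{-1/2}e^{-t^2/2}h_{k-1}(\sqrt2\,t)$, $k\ge1$; $\{\xi_k\}_{k\ge 1}$ is an orthonormal basis of $L^2(\mathbb{R})$. $\{e_i\}_{i\ge1}$ is a fixed enumeration of all tensor products $\xi_{\beta_1}\otimes\cdots\otimes\xi_{\beta_n}$, $\beta\in\mathbb{N}^n$, $\mathbb{N}=\{1,2,\dots\}$, in order of nondecreasing $\beta_1+\dots+\beta_n$; it is an orthonormal basis of $L^2(\mathbb{R}^n)$. Indices. $\kappa:\mathbb{N}\times\mathbb{N}\to\mathbb{N}$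 is the bijection $\kappa(i,j)=j+(i+j-2)(i+j-1)/2$. $\mathcal{J}$ is the set of finite multi-indices $\alpha=(\alpha_1,\alpha_2,\dots)$ of nonnegative integers (only finitely many nonzero entries); $|\alpha|=\sum_k\alpha_k$, $\alpha!=\prod_k\alpha_k!$. $\varepsilon^{(k)}\in\mathcal{J}$ has entry $1$ in position $k$ and $0$ elsewhere, and $\varepsilon^{(i,j)}:=\varepsilon^{(\kappa(i,j))}$. Further, $(2\mathbb{N})^{k\alpha}:=\prod_{j\ge1}(2j)^{k\alpha_j}$ for integers $k$. Chaos basis and distributions. $\mathbb{P}$ is the probability law of the pure jump Lévy sheet with Lévy measure $\nu$, and $\widetilde N$ is its compensated Poisson random measure on $\mathbb{R}^n\times\mathbb{R}_0$, with compensator $\nu(dz)\,dx$. $\{K_\alpha\}_{\alpha\in\mathcal{J}}$ is the orthogonal basis of $L^2(\mathbb{P})$, with $\|K_\alpha\|^2_{L^2(\mathbb{P})}=\alpha!$, given by $K_\alpha=I_{|\alpha|}(\theta^{\hat\otimes\alpha})$, where $I_m$ is the $m$-fold iterated integral with respect to $\widetilde N$, $\theta_{\kappa(j,k)}(x,z)=e_j(x)p_k(z)$, and $\theta^{\hat\otimes\alpha}$ is the symmetrization of $\theta_1^{\otimes\alpha_1}\otimes\theta_2^{\otimes\alpha_2}\otimes\cdots$; in particular $K_{\varepsilon^{(i,j)}}=\int_{\mathbb{R}^n}\int_{\mathbb{R}_0}e_i(x)p_j(z)\,\widetilde{N}(dx,dz)$. The Lévy-Hida space $(\mathcal{S})^*$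 of stochastic distributions is the set of all formal expansions $F=\sum_{\alpha\in\mathcal{J}}b_\alpha K_\alpha$, $b_\alpha\in\mathbb{R}$, such that $\sum_{\alpha\in\mathcal{J}}b_\alpha^2\,\alpha!\,(2\mathbb{N})^{-q\alpha}<\infty$ for some $q\in\mathbb{N}$.
   Formalization: The last claim is proved for ν-almost every z (and then all x), not for all z: for ν = Lebesgue measure on [1,2] and z = 10 the values p_j(z) grow exponentially in j, so the expansion of the white noise of Ñ is not in (S)*. *)

theory Defs
  imports "HOL-Probability.Probability" "HOL-Library.Landau_Symbols"
begin

section \<open>Levy measures and the associated polynomials\<close>

definition levy_measure :: "real measure \<Rightarrow> bool" where
  "levy_measure \<nu> \<longleftrightarrow>
     sets \<nu> = sets (restrict_space borel (- {0})) \<and>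
     (\<integral>\<^sup>+ z. ennreal (z\<^sup>2) \<partial>\<nu>) < \<infinity> \<and>
     (\<forall>\<epsilon>>0. \<exists>l>0. (\<integral>\<^sup>+ z \<in> - {-\<epsilon><..<\<epsilon>}. ennreal (exp (l * \<bar>z\<bar>)) \<partial>\<nu>) < \<infinity>)"

definition rho :: "real measure \<Rightarrow> real measure" where
  "rho \<nu> = density \<nu> (\<lambda>z. ennreal (z\<^sup>2))"

definition m2 :: "real measure \<Rightarrow> real" where
  "m2 \<nu> = sqrt (\<integral> z. z\<^sup>2 \<partial>\<nu>)"

text \<open>Gram-Schmidt orthogonalization of \<open>1, z, z\<^sup>2, \<dots>\<close> in \<open>L\<^sup>2(\<rho>)\<close>. The \<open>eta\<close> are
  monic and not normalized. If \<open>\<nu>\<close> is carried by finitely many points, then \<open>eta \<nu> m\<close>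
  has norm \<open>0\<close> for large \<open>m\<close>, and \<open>levy_poly \<nu> j = 0\<close> for large \<open>j\<close> since \<open>x / 0 = 0\<close>.\<close>

fun eta :: "real measure \<Rightarrow> nat \<Rightarrow> real \<Rightarrow> real" where
  "eta \<nu> m = (\<lambda>z. z ^ m -
     (\<Sum>l\<in>{..<m}. (\<integral> y. y ^ m * eta \<nu> l y \<partial>rho \<nu>) / (\<integral> y. (eta \<nu> l y)\<^sup>2 \<partial>rho \<nu>) * eta \<nu> l z))"

declare eta.simps [simp del]

text \<open>These polynomials are representatives of elements of \<open>L\<^sup>2(\<nu>)\<close>. Off the support of \<open>\<nu>\<close> their
  values can grow exponentially in \<open>j\<close>, so pointwise statements about the whole sequence are
  to be read for \<open>\<nu>\<close>-almost every \<open>z\<close>.\<close>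

definition levy_poly :: "real measure \<Rightarrow> nat \<Rightarrow> real \<Rightarrow> real" where
  "levy_poly \<nu> j z = z * eta \<nu> (j - 1) z / sqrt (\<integral> y. (eta \<nu> (j - 1) y)\<^sup>2 \<partial>rho \<nu>)"


section \<open>Hermite functions and the basis of \<open>L\<^sup>2(\<real>\<^sup>n)\<close>\<close>

definition hermite :: "nat \<Rightarrow> real \<Rightarrow> real" where
  "hermite k t = (-1) ^ k * exp (t\<^sup>2 / 2) * (deriv ^^ k) (\<lambda>s. exp (- s\<^sup>2 / 2)) t"

text \<open>Hermite functions; only indices \<open>k \<ge> 1\<close> are meaningful.\<close>

definition xi :: "nat \<Rightarrow> real \<Rightarrow> real" where
  "xi k t = pi powr (-1/4) * fact (k - 1) powr (-1/2) * exp (- t\<^sup>2 / 2) * hermite (k - 1) (sqrt 2 * t)"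

definition hermite_tensor :: "('n::finite \<Rightarrow> nat) \<Rightarrow> real ^ 'n \<Rightarrow> real" where
  "hermite_tensor \<beta> x = (\<Prod>k\<in>UNIV. xi (\<beta> k) (x $ k))"

text \<open>\<open>e 1, e 2, \<dots>\<close> lists every tensor product exactly once; \<open>e 0\<close> is not used.\<close>

definition hermite_enumeration :: "(nat \<Rightarrow> (real ^ 'n::finite) \<Rightarrow> real) \<Rightarrow> bool" where
  "hermite_enumeration e \<longleftrightarrow>
     (\<exists>b :: nat \<Rightarrow> 'n \<Rightarrow> nat.
        bij_betw b {1..} {\<beta>. \<forall>k. 1 \<le> \<beta> k} \<and>
        (\<forall>i j. 1 \<le> i \<and> i \<le> j \<longrightarrow> (\<Sum>k\<in>UNIV. b i k) \<le> (\<Sum>k\<in>UNIV. b j k)) \<and>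
        (\<forall>i\<ge>1. e i = hermite_tensor (b i)))"


section \<open>Multi-indices\<close>

text \<open>Meant for \<open>i, j \<ge> 1\<close>; there the truncated subtraction and \<open>div\<close> are exact.\<close>

definition kappa :: "nat \<Rightarrow> nat \<Rightarrow> nat" where
  "kappa i j = j + (i + j - 2) * (i + j - 1) div 2"

text \<open>Positions are numbered from \<open>1\<close>, so that position \<open>0\<close> is kept empty.\<close>

definition multi_indices :: "(nat \<Rightarrow> nat) set" where
  "multi_indices = {\<alpha>. finite {k. \<alpha> k \<noteq> 0} \<and> \<alpha> 0 = 0}"

definition mi_abs :: "(nat \<Rightarrow> nat) \<Rightarrow> nat" where
  "mi_abs \<alpha> = (\<Sum>k | \<alpha> k \<noteq> 0. \<alpha> k)"

definition mi_fact :: "(nat \<Rightarrow> nat) \<Rightarrow> real" where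
  "mi_fact \<alpha> = (\<Prod>k | \<alpha> k \<noteq> 0. fact (\<alpha> k))"

definition mi_unit :: "nat \<Rightarrow> nat \<Rightarrow> nat" where
  "mi_unit k = (\<lambda>l. if l = k then 1 else 0)"

definition mi_unit2 :: "nat \<Rightarrow> nat \<Rightarrow> nat \<Rightarrow> nat" where
  "mi_unit2 i j = mi_unit (kappa i j)"

text \<open>\<open>two_N k \<alpha>\<close> is \<open>(2\<nat>)\<close> to the power \<open>k \<alpha>\<close>.\<close>

definition two_N :: "int \<Rightarrow> (nat \<Rightarrow> nat) \<Rightarrow> real" where
  "two_N k \<alpha> = (\<Prod>j | \<alpha> j \<noteq> 0. (2 * real j) powi (k * int (\<alpha> j)))"


section \<open>Poisson random measures and multiple integrals\<close>

text \<open>\<open>P\<close> may be any probability space carrying a Poisson random measure; the law of the Levy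
  sheet with its jump measure is one.\<close>

definition poisson_random_measure :: "'w measure \<Rightarrow> ('w \<Rightarrow> 'e measure) \<Rightarrow> 'e measure \<Rightarrow> bool" where
  "poisson_random_measure P N \<mu> \<longleftrightarrow>
     prob_space P \<and>
     (\<forall>\<omega>\<in>space P. sets (N \<omega>) = sets \<mu>) \<and>
     (\<forall>A\<in>sets \<mu>. (\<lambda>\<omega>. emeasure (N \<omega>) A) \<in> borel_measurable P) \<and>
     (\<forall>A\<in>sets \<mu>. emeasure \<mu> A < \<infinity> \<longrightarrow>
        (\<forall>k::nat. measure P {\<omega> \<in> space P. emeasure (N \<omega>) A = of_nat k} =
                  exp (- measure \<mu> A) * measure \<mu> A ^ k / fact k)) \<and>
     (\<forall>A :: nat \<Rightarrow> 'e set. range A \<subseteq> sets \<mu> \<and> disjoint_family A \<longrightarrow>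
        prob_space.indep_vars P (\<lambda>_. borel) (\<lambda>i \<omega>. emeasure (N \<omega>) (A i)) UNIV)"

definition compensated :: "('w \<Rightarrow> 'e measure) \<Rightarrow> 'e measure \<Rightarrow> 'w \<Rightarrow> 'e set \<Rightarrow> real" where
  "compensated N \<mu> \<omega> A = measure (N \<omega>) A - measure \<mu> A"

text \<open>Elementary functions of \<open>m\<close> variables: linear combinations of indicators of products of
  members of a finite disjoint family \<open>A 0, \<dots>, A (r - 1)\<close>, vanishing on the diagonals.
  Points of the \<open>m\<close>-fold product are functions on \<open>{..<m}\<close>.\<close>

definition elementary ::
  "'e measure \<Rightarrow> nat \<Rightarrow> nat \<Rightarrow> (nat \<Rightarrow> 'e set) \<Rightarrow> ((nat \<Rightarrow> nat) \<Rightarrow> real) \<Rightarrow> bool" where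
  "elementary \<mu> m r A a \<longleftrightarrow>
     (\<forall>i<r. A i \<in> sets \<mu> \<and> emeasure \<mu> (A i) < \<infinity>) \<and>
     disjoint_family_on A {..<r} \<and>
     (\<forall>s. \<not> inj_on s {..<m} \<longrightarrow> a s = 0)"

definition elementary_fun ::
  "nat \<Rightarrow> nat \<Rightarrow> (nat \<Rightarrow> 'e set) \<Rightarrow> ((nat \<Rightarrow> nat) \<Rightarrow> real) \<Rightarrow> (nat \<Rightarrow> 'e) \<Rightarrow> real" where
  "elementary_fun m r A a y =
     (\<Sum>s \<in> {..<m} \<rightarrow>\<^sub>E {..<r}. a s * (\<Prod>k<m. indicator (A (s k)) (y k)))"

definition elementary_integral ::
  "('w \<Rightarrow> 'e measure) \<Rightarrow> 'e measure \<Rightarrow> nat \<Rightarrow> nat \<Rightarrow> (nat \<Rightarrow> 'e set) \<Rightarrow> ((nat \<Rightarrow> nat) \<Rightarrow> real)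
    \<Rightarrow> 'w \<Rightarrow> real" where
  "elementary_integral N \<mu> m r A a \<omega> =
     (\<Sum>s \<in> {..<m} \<rightarrow>\<^sub>E {..<r}. a s * (\<Prod>k<m. compensated N \<mu> \<omega> (A (s k))))"

text \<open>\<open>X\<close> is (a version of) the \<open>m\<close>-fold integral \<open>I\<^sub>m(f)\<close>, the \<open>L\<^sup>2\<close>-limit of elementary
  integrals. For symmetric \<open>f\<close> it is \<open>m!\<close> times the integral over ordered points, so
  that \<open>\<parallel>I\<^sub>m(f)\<parallel>\<^sup>2 = m! \<parallel>f\<parallel>\<^sup>2\<close>; this is the normalization giving \<open>\<parallel>K\<^sub>\<alpha>\<parallel>\<^sup>2 = \<alpha>!\<close>.\<close>

definition is_multiple_integral ::
  "'w measure \<Rightarrow> ('w \<Rightarrow> 'e measure) \<Rightarrow> 'e measure \<Rightarrow> nat \<Rightarrow> ((nat \<Rightarrow> 'e) \<Rightarrow> real) \<Rightarrow> ('w \<Rightarrow> real)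
    \<Rightarrow> bool" where
  "is_multiple_integral P N \<mu> m f X \<longleftrightarrow>
     X \<in> borel_measurable P \<and>
     (\<exists>r A a.
        (\<forall>k. elementary \<mu> m (r k) (A k) (a k)) \<and>
        (\<lambda>k::nat. \<integral>\<^sup>+ y. ennreal ((f y - elementary_fun m (r k) (A k) (a k) y)\<^sup>2)
                 \<partial>(\<Pi>\<^sub>M i\<in>{..<m}. \<mu>)) \<longlonglongrightarrow> 0 \<and>
        (\<lambda>k. \<integral>\<^sup>+ \<omega>. ennreal ((X \<omega> - elementary_integral N \<mu> m (r k) (A k) (a k) \<omega>)\<^sup>2) \<partial>P)
          \<longlonglongrightarrow> 0)"


section \<open>The chaos basis\<close>

definition intensity :: "real measure \<Rightarrow> ((real ^ 'n::finite) \<times> real) measure" where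
  "intensity \<nu> = lborel \<Otimes>\<^sub>M \<nu>"

definition theta ::
  "real measure \<Rightarrow> (nat \<Rightarrow> (real ^ 'n::finite) \<Rightarrow> real) \<Rightarrow> nat \<Rightarrow> (real ^ 'n) \<times> real \<Rightarrow> real" where
  "theta \<nu> e l =
     (case inv_into ({1..} \<times> {1..}) (\<lambda>(j, k). kappa j k) l of
        (j, k) \<Rightarrow> (\<lambda>(x, z). e j x * levy_poly \<nu> k z))"

text \<open>The list \<open>1, \<dots>, 1, 2, \<dots>, 2, \<dots>\<close> in which \<open>l\<close> occurs \<open>\<alpha> l\<close> times; its length is \<open>mi_abs \<alpha>\<close>.\<close>

definition mi_list :: "(nat \<Rightarrow> nat) \<Rightarrow> nat list" where
  "mi_list \<alpha> = sorted_list_of_multiset (Abs_multiset \<alpha>)"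

definition tensor_power :: "(nat \<Rightarrow> 'e \<Rightarrow> real) \<Rightarrow> (nat \<Rightarrow> nat) \<Rightarrow> (nat \<Rightarrow> 'e) \<Rightarrow> real" where
  "tensor_power \<theta> \<alpha> y = (\<Prod>k<mi_abs \<alpha>. \<theta> (mi_list \<alpha> ! k) (y k))"

definition symmetrize :: "nat \<Rightarrow> ((nat \<Rightarrow> 'e) \<Rightarrow> real) \<Rightarrow> (nat \<Rightarrow> 'e) \<Rightarrow> real" where
  "symmetrize m f y = (\<Sum>\<pi> | \<pi> permutes {..<m}. f (y \<circ> \<pi>)) / fact m"

definition chaos_basis ::
  "'w measure \<Rightarrow> ('w \<Rightarrow> ((real ^ 'n::finite) \<times> real) measure) \<Rightarrow> real measure
    \<Rightarrow> (nat \<Rightarrow> real ^ 'n \<Rightarrow> real) \<Rightarrow> ((nat \<Rightarrow> nat) \<Rightarrow> 'w \<Rightarrow> real) \<Rightarrow> bool" where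
  "chaos_basis P N \<nu> e K \<longleftrightarrow>
     (\<forall>\<alpha>\<in>multi_indices.
        is_multiple_integral P N (intensity \<nu>) (mi_abs \<alpha>)
          (symmetrize (mi_abs \<alpha>) (tensor_power (theta \<nu> e) \<alpha>)) (K \<alpha>))"


section \<open>Stochastic distributions\<close>

text \<open>A formal expansion \<open>\<Sum>\<^sub>\<alpha> b\<^sub>\<alpha> K\<^sub>\<alpha>\<close> is the family of its terms; no convergence is involved.\<close>

definition formal_expansion ::
  "((nat \<Rightarrow> nat) \<Rightarrow> 'w \<Rightarrow> real) \<Rightarrow> ((nat \<Rightarrow> nat) \<Rightarrow> real) \<Rightarrow> (nat \<Rightarrow> nat) \<Rightarrow> 'w \<Rightarrow> real" where
  "formal_expansion K b = (\<lambda>\<alpha>\<in>multi_indices. (\<lambda>\<omega>. b \<alpha> * K \<alpha> \<omega>))"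

definition levy_hida :: "((nat \<Rightarrow> nat) \<Rightarrow> 'w \<Rightarrow> real) \<Rightarrow> ((nat \<Rightarrow> nat) \<Rightarrow> 'w \<Rightarrow> real) set" where
  "levy_hida K =
     {formal_expansion K b | b.
        \<exists>q::nat. 1 \<le> q \<and>
          (\<lambda>\<alpha>. (b \<alpha>)\<^sup>2 * mi_fact \<alpha> * two_N (- int q) \<alpha>) summable_on multi_indices}"

definition levy_noise_coeff ::
  "real measure \<Rightarrow> (nat \<Rightarrow> (real ^ 'n::finite) \<Rightarrow> real) \<Rightarrow> real ^ 'n \<Rightarrow> (nat \<Rightarrow> nat) \<Rightarrow> real" where
  "levy_noise_coeff \<nu> e x \<alpha> =
     (if \<exists>i\<ge>1. \<alpha> = mi_unit2 i 1
      then m2 \<nu> * e (THE i. 1 \<le> i \<and> \<alpha> = mi_unit2 i 1) x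
      else 0)"

definition levy_noise where
  "levy_noise K \<nu> e x = formal_expansion K (levy_noise_coeff \<nu> e x)"

definition poisson_noise_coeff ::
  "real measure \<Rightarrow> (nat \<Rightarrow> (real ^ 'n::finite) \<Rightarrow> real) \<Rightarrow> real ^ 'n \<Rightarrow> real \<Rightarrow> (nat \<Rightarrow> nat) \<Rightarrow> real" where
  "poisson_noise_coeff \<nu> e x z \<alpha> =
     (if \<exists>i\<ge>1. \<exists>j\<ge>1. \<alpha> = mi_unit2 i j
      then (case (THE (i, j). 1 \<le> i \<and> 1 \<le> j \<and> \<alpha> = mi_unit2 i j) of (i, j) \<Rightarrow> e i x * levy_poly \<nu> j z)
      else 0)"

definition poisson_noise where
  "poisson_noise K \<nu> e x z = formal_expansion K (poisson_noise_coeff \<nu> e x z)"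

end

(* The Hermite function y = xi m solves y'' = (t^2 - L) y with L = 2 m - 1. With s = sqrt (L - t^2), the
   first-order WKB correction W = s y^2 + y'^2 / s - (t / s^3) y y' of the adiabatic invariant has
   logarithmic derivative bounded by the derivative of t / s^3, so W stays bounded up to the edge
   L - t^2 = L^(1/3) of the Airy zone, where this gives |y| = O(L^(-1/12)). The zone has width at most
   L^(-1/6), and there the energy y'^2 + (L - t^2) y^2 decreases, so |y'| = O(L^(1/12)) and y changes
   by O(L^(-1/12)). Beyond sqrt L the function y^2 is convex and tends to 0, hence decreases.

   For the Poisson noise, the integral of sum_j p_j^2 / j^2 against nu is at most sum_j 1 / j^2, so
   the sum is finite nu-almost everywhere, and kappa(i,j)^4 >= i^2 j^2. *)
theory Submission
  imports Defs "HOL-Real_Asymp.Real_Asymp"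
begin

section \<open>Oscillators with a turning point\<close>

text \<open>The last hypothesis on \<open>T\<close> says that the correction coefficient
  \<open>A\<close> satisfies |A| \<le> 1 on [0, T], so that \<open>W\<close> is at least
  \<open>F / 2\<close>. The constant 18 is 2 * 3 * 3: one factor from \<open>F / 2\<close>, one from
  the initial energy, one from the bound exp 1 \<le> 3 on the integrating factor.\<close>

lemma oscillator_bound_before_turning_point:
  fixes y y' :: "real \<Rightarrow> real" and L T :: real
  assumes y: "\<And>t. (y has_real_derivative y' t) (at t)"
    and y': "\<And>t. (y' has_real_derivative (t\<^sup>2 - L) * y t) (at t)"
    and init: "(y' 0)\<^sup>2 + L * (y 0)\<^sup>2 \<le> 3 * sqrt L"
    and T: "0 \<le> T" "T\<^sup>2 < L" "T \<le> sqrt (L - T\<^sup>2) ^ 3"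
  shows "(y' T)\<^sup>2 + (L - T\<^sup>2) * (y T)\<^sup>2 \<le> 18 * sqrt (L - T\<^sup>2)"
proof -
  define s where "s t = sqrt (L - t\<^sup>2)" for t
  define A where "A t = - t / s t ^ 3" for t
  define A' where "A' t = - (1 / s t ^ 3 + 3 * t\<^sup>2 / s t ^ 5)" for t
  define F where "F t = s t * (y t)\<^sup>2 + (y' t)\<^sup>2 / s t" for t
  define W where "W t = F t + A t * (y t * y' t)" for t
  have sq: "t\<^sup>2 < L" if "0 \<le> t" "t \<le> T" for t
    using that T power_mono[of t T 2] by linarith
  have spos: "s t > 0" and s2: "L - t\<^sup>2 = s t * s t" if "0 \<le> t" "t \<le> T" for t
    using sq[OF that] by (auto simp: s_def)
  have sT: "s T \<le> s t" if "0 \<le> t" "t \<le> T" for t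
    using power_mono[of t T 2] that by (simp add: s_def)
  have A1: "\<bar>A t\<bar> \<le> 1" if "0 \<le> t" "t \<le> T" for t
  proof -
    have "t \<le> s T ^ 3" using that T by (simp add: s_def)
    also have "\<dots> \<le> s t ^ 3" using sT[OF that] spos[of T] T by (intro power_mono) auto
    finally show ?thesis using that spos[OF that] by (simp add: A_def divide_simps)
  qed
  have yy: "\<bar>y t * y' t\<bar> \<le> F t / 2" if "0 \<le> t" "t \<le> T" for t
  proof -
    have "F t - 2 * (y t * y' t) = (s t * y t - y' t)\<^sup>2 / s t"
         "F t + 2 * (y t * y' t) = (s t * y t + y' t)\<^sup>2 / s t"
      using spos[OF that] by (auto simp: F_def field_simps power2_eq_square)
    moreover have "0 \<le> (s t * y t - y' t)\<^sup>2 / s t" "0 \<le> (s t * y t + y' t)\<^sup>2 / s t"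
      using spos[OF that] by auto
    ultimately have "0 \<le> F t - 2 * (y t * y' t)" "0 \<le> F t + 2 * (y t * y' t)"
      by simp_all
    then show ?thesis by linarith
  qed
  have FW: "F t / 2 \<le> W t" if "0 \<le> t" "t \<le> T" for t
  proof -
    have "\<bar>A t * (y t * y' t)\<bar> \<le> 1 * (F t / 2)"
      unfolding abs_mult[of "A t"] using A1[OF that] yy[OF that] by (intro mult_mono) auto
    then show ?thesis by (simp add: W_def)
  qed
  have Ds: "(s has_real_derivative (- t / s t)) (at t)" if "0 \<le> t" "t \<le> T" for t
    unfolding s_def using sq[OF that]
    by (auto intro!: derivative_eq_intros simp: field_simps)
  have DA: "(A has_real_derivative A' t) (at t)" if "0 \<le> t" "t \<le> T" for t
    unfolding A_def A'_def using spos[OF that]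
    by (auto intro!: derivative_eq_intros Ds that simp: field_simps eval_nat_numeral)
  \<comment> \<open>The derivative of \<open>F\<close> is (t / s^3) (y'^2 - s^2 y^2). The choice A =
    - t / s^3 makes \<open>A\<close> times the derivative of y y' cancel it exactly, and only the
    term with \<open>A'\<close> survives.\<close>
  have DW: "(W has_real_derivative (A' t * (y t * y' t))) (at t)" if "0 \<le> t" "t \<le> T" for t
  proof -
    have dF: "(F has_real_derivative (- t / s t * (y t)\<^sup>2 + s t * (2 * y t * y' t) +
        (2 * y' t * (- (s t * s t) * y t) * s t - (y' t)\<^sup>2 * (- t / s t)) / (s t * s t))) (at t)"
      unfolding F_def using spos[OF that] s2[OF that]
      by (auto intro!: derivative_eq_intros Ds y y' that simp: power2_eq_square algebra_simps)
    have dG: "((\<lambda>t. A t * (y t * y' t)) has_real_derivative (A' t * (y t * y' t)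
         + A t * (y' t * y' t + y t * (- (s t * s t) * y t)))) (at t)"
      using spos[OF that] s2[OF that]
      by (auto intro!: derivative_eq_intros DA y y' that simp: power2_eq_square algebra_simps)
    have "(W has_real_derivative (- t / s t * (y t)\<^sup>2 + s t * (2 * y t * y' t) +
        (2 * y' t * (- (s t * s t) * y t) * s t - (y' t)\<^sup>2 * (- t / s t)) / (s t * s t)
        + (A' t * (y t * y' t) + A t * (y' t * y' t + y t * (- (s t * s t) * y t))))) (at t)"
      unfolding W_def by (rule DERIV_add[OF dF dG])
    also have "- t / s t * (y t)\<^sup>2 + s t * (2 * y t * y' t) +
        (2 * y' t * (- (s t * s t) * y t) * s t - (y' t)\<^sup>2 * (- t / s t)) / (s t * s t)
        + (A' t * (y t * y' t) + A t * (y' t * y' t + y t * (- (s t * s t) * y t)))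
        = A' t * (y t * y' t)"
      using spos[OF that] by (simp add: A_def field_simps power2_eq_square power3_eq_cube)
    finally show ?thesis .
  qed
  \<comment> \<open>\<open>exp (A t)\<close> is an integrating factor: since \<open>A' t\<close> is
    negative or zero and \<open>W\<close> dominates |y y'|, the product \<open>W * exp A\<close>
    cannot increase. This avoids any integration of |A'|.\<close>
  have "W T * exp (A T) \<le> W 0 * exp (A 0)"
  proof (rule DERIV_nonpos_imp_nonincreasing[where f = "\<lambda>t. W t * exp (A t)"])
    fix t assume t: "0 \<le> t" "t \<le> T"
    have "((\<lambda>t. W t * exp (A t)) has_real_derivative
        (A' t * (y t * y' t) + W t * A' t) * exp (A t)) (at t)"
      by (auto intro!: derivative_eq_intros DW DA t simp: algebra_simps)
    moreover have "(A' t * (y t * y' t) + W t * A' t) * exp (A t) \<le> 0"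
    proof (rule mult_nonpos_nonneg)
      have "A' t \<le> 0"
        unfolding A'_def neg_le_0_iff_le
        by (intro add_nonneg_nonneg) (use spos[OF t] in auto)
      moreover have "0 \<le> y t * y' t + W t"
        using yy[OF t] FW[OF t] by linarith
      ultimately have "A' t * (y t * y' t + W t) \<le> 0"
        by (rule mult_nonpos_nonneg)
      then show "A' t * (y t * y' t) + W t * A' t \<le> 0" by (simp add: algebra_simps)
    qed simp
    ultimately show "\<exists>d. ((\<lambda>t. W t * exp (A t)) has_real_derivative d) (at t) \<and> d \<le> 0"
      by blast
  qed (use T in auto)
  moreover have "W 0 * exp (A 0) \<le> 3"
  proof -
    have L: "0 < L" using sq[of 0] T by simp
    \<comment> \<open>At 0 the correction vanishes, because A(0) = 0, and s(0) = sqrt L.\<close>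
    have "W 0 * exp (A 0) = ((y' 0)\<^sup>2 + L * (y 0)\<^sup>2) / sqrt L"
      using L by (simp add: W_def A_def F_def s_def field_simps)
    also have "\<dots> \<le> 3" using init L by (simp add: field_simps)
    finally show ?thesis .
  qed
  ultimately have *: "W T * exp (A T) \<le> 3" by linarith
  have F0: "0 \<le> F T" using spos[of T] T by (simp add: F_def)
  have "F T / 2 * exp (-1) \<le> W T * exp (A T)"
    using FW[of T] A1[of T] T F0 by (intro mult_mono) auto
  with * have "F T / 2 * exp (-1) \<le> 3" by linarith
  then have "F T \<le> 6 * exp 1" by (simp add: exp_minus field_simps)
  also have "\<dots> \<le> 18" using exp_le by simp
  finally have "F T * s T \<le> 18 * s T" using spos[of T] T by simp
  moreover have "F T * s T = (y' T)\<^sup>2 + (L - T\<^sup>2) * (y T)\<^sup>2"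
    unfolding s2[OF T(1) order_refl] using spos[of T] T by (simp add: F_def field_simps power2_eq_square)
  ultimately show ?thesis by (simp add: s_def)
qed

text \<open>A positive slope at some point would persist by convexity, the graph would stay above
  its tangent there, and the function would tend to infinity instead of 0.\<close>

lemma convex_tendsto_0_imp_nonincreasing:
  fixes f f' f'' :: "real \<Rightarrow> real"
  assumes f: "\<And>t. (f has_real_derivative f' t) (at t)"
    and f': "\<And>t. (f' has_real_derivative f'' t) (at t)"
    and pos: "\<And>t. a \<le> t \<Longrightarrow> 0 \<le> f'' t"
    and lim: "(f \<longlongrightarrow> 0) at_top"
    and t: "a \<le> t"
  shows "f t \<le> f a"
proof (rule DERIV_nonpos_imp_nonincreasing[OF t])
  fix u assume u: "a \<le> u" "u \<le> t"
  have "f' u \<le> 0"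
  proof (rule ccontr)
    assume "\<not> f' u \<le> 0"
    then have p: "f' u > 0" by simp
    have mono: "f' u \<le> f' v" if "u \<le> v" for v
      using that by (rule DERIV_nonneg_imp_nondecreasing) (use f' pos u in \<open>meson order_trans\<close>)
    have lin: "f u + f' u * (v - u) \<le> f v" if "u \<le> v" for v
    proof -
      have "f u - f' u * (u - u) \<le> f v - f' u * (v - u)"
        using that
      proof (rule DERIV_nonneg_imp_nondecreasing)
        fix w assume w: "u \<le> w" "w \<le> v"
        have "((\<lambda>v. f v - f' u * (v - u)) has_real_derivative (f' w - f' u)) (at w)"
          by (auto intro!: derivative_eq_intros f)
        then show "\<exists>d. ((\<lambda>v. f v - f' u * (v - u)) has_real_derivative d) (at w) \<and> 0 \<le> d"
          using mono[OF w(1)] by force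
      qed
      then show ?thesis by simp
    qed
    have "filterlim (\<lambda>v. f u + f' u * (v - u)) at_top at_top"
      using p by real_asymp
    then have "filterlim f at_top at_top"
      by (rule filterlim_at_top_mono)
         (rule eventually_mono[OF eventually_ge_at_top[of u] lin])
    then show False
      using lim not_tendsto_and_filterlim_at_infinity[of at_top f 0]
      by (auto dest: filterlim_at_top_imp_at_infinity)
  qed
  then show "\<exists>d. (f has_real_derivative d) (at u) \<and> d \<le> 0" using f by blast
qed

text \<open>With r = L^(1/12) every scale is an integer power: L = r^12, the turning point sqrt L is
  r^6, and the edge \<open>T\<close> of the Airy zone is where L - t^2 = r^4. The bound is 9 / (2 r)
  on [0, T], grows by at most as much again on [T, r^6], and is inherited beyond r^6.\<close>

lemma oscillator_bound:
  fixes y y' :: "real \<Rightarrow> real" and L t :: real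
  assumes y: "\<And>t. (y has_real_derivative y' t) (at t)"
    and y': "\<And>t. (y' has_real_derivative (t\<^sup>2 - L) * y t) (at t)"
    and lim: "(y \<longlongrightarrow> 0) at_top"
    and init: "(y' 0)\<^sup>2 + L * (y 0)\<^sup>2 \<le> 3 * sqrt L"
    and L: "1 \<le> L" and t: "0 \<le> t"
  shows "\<bar>y t\<bar> \<le> 9 * L powr (-1/12)"
proof -
  define r where "r = L powr (1/12)"
  have r1: "1 \<le> r" using L by (simp add: r_def ge_one_powr_ge_zero)
  have r12: "L = r ^ 12" using L by (simp add: r_def powr_power)
  have rinv: "L powr (-1/12) = 1 / r"
    using powr_minus[of L "1/12"] by (simp add: r_def field_simps)
  have sqL: "sqrt L = r ^ 6"
    using r1 by (intro real_sqrt_unique) (auto simp: r12 simp flip: power_mult)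
  define T where "T = sqrt (L - r ^ 4)"
  have r4: "r ^ 4 \<le> L" unfolding r12 by (rule power_increasing) (use r1 in auto)
  have T0: "0 \<le> T" using r4 by (simp add: T_def)
  have T2: "L - T\<^sup>2 = r ^ 4" using r4 by (simp add: T_def)
  have sr4: "sqrt (r ^ 4) = r\<^sup>2"
    using r1 by (intro real_sqrt_unique) (auto simp flip: power_mult)
  have TL: "T \<le> r ^ 6" using r1 unfolding T_def sqL[symmetric] by simp
  have before: "(y' u)\<^sup>2 + (L - u\<^sup>2) * (y u)\<^sup>2 \<le> 18 * sqrt (L - u\<^sup>2) \<and> r\<^sup>2 \<le> sqrt (L - u\<^sup>2)"
    if "0 \<le> u" "u \<le> T" for u
  proof -
    have "u\<^sup>2 \<le> T\<^sup>2" using that by (intro power_mono)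
    then have g: "r ^ 4 \<le> L - u\<^sup>2" using T2 by linarith
    then have s: "r\<^sup>2 \<le> sqrt (L - u\<^sup>2)"
      unfolding sr4[symmetric] by simp
    have "0 < r ^ 4" using r1 by simp
    then have "u\<^sup>2 < L" using g by linarith
    \<comment> \<open>This decides the width of the Airy zone: L - u^2 \<ge> r^4 gives s^3 \<ge> r^6
      = sqrt L, which is at least u.\<close>
    moreover have "u \<le> sqrt (L - u\<^sup>2) ^ 3"
    proof -
      have "u \<le> (r\<^sup>2) ^ 3" using that TL by (simp flip: power_mult)
      also have "\<dots> \<le> sqrt (L - u\<^sup>2) ^ 3" using s by (intro power_mono) auto
      finally show ?thesis .
    qed
    ultimately show ?thesis
      using oscillator_bound_before_turning_point[OF y y' init that(1)] s by blast
  qed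
  \<comment> \<open>A rational substitute for the square root of 18: (9/2)^2 = 81/4.\<close>
  have 18: "z \<le> 9/2 * c" if "z\<^sup>2 \<le> 18 * c\<^sup>2" "0 \<le> c" for z c :: real
  proof -
    have "z\<^sup>2 \<le> (9/2 * c)\<^sup>2"
      using that zero_le_power2[of c] unfolding power_mult_distrib power2_eq_square[of "9/2"] by linarith
    then show ?thesis using that by (simp add: power2_le_iff_abs_le)
  qed
  have b1: "\<bar>y u\<bar> \<le> 9/2 * (1 / r)" if "0 \<le> u" "u \<le> T" for u
  proof -
    define s where "s = sqrt (L - u\<^sup>2)"
    have s: "r\<^sup>2 \<le> s" "(y' u)\<^sup>2 + (L - u\<^sup>2) * (y u)\<^sup>2 \<le> 18 * s"
      using before[OF that] by (auto simp: s_def)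
    have "0 < s" using s(1) r1 by (smt (verit) zero_less_power)
    moreover from this have "L - u\<^sup>2 = s * s" by (simp add: s_def)
    ultimately have "s * (s * (y u)\<^sup>2) \<le> s * 18" using s by (smt (verit) mult.assoc mult.commute zero_le_power2)
    then have "s * (y u)\<^sup>2 \<le> 18" using \<open>0 < s\<close> by simp
    moreover have "r\<^sup>2 * (y u)\<^sup>2 \<le> s * (y u)\<^sup>2" by (intro mult_right_mono s) simp
    ultimately have "(y u)\<^sup>2 \<le> 18 * (1 / r)\<^sup>2" using r1 by (simp add: field_simps)
    then show ?thesis using r1 by (intro 18) auto
  qed
  have b2: "\<bar>y u\<bar> \<le> 9 * (1 / r)" if "T \<le> u" "u \<le> r ^ 6" for u
  proof -
    \<comment> \<open>The energy y'^2 + (L - v^2) y^2 has derivative - 2 v y^2. Up to r^6 its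
      potential term is still nonnegative, so the energy at \<open>T\<close> bounds the
      slope.\<close>
    have E: "\<bar>y' w\<bar> \<le> 9/2 * r" if "T \<le> w" "w \<le> r ^ 6" for w
    proof -
      have "(y' w)\<^sup>2 + (L - w\<^sup>2) * (y w)\<^sup>2 \<le> (y' T)\<^sup>2 + (L - T\<^sup>2) * (y T)\<^sup>2"
        using that(1)
      proof (rule DERIV_nonpos_imp_nonincreasing)
        fix v assume v: "T \<le> v" "v \<le> w"
        have "((\<lambda>v. (y' v)\<^sup>2 + (L - v\<^sup>2) * (y v)\<^sup>2) has_real_derivative (- (2 * v * (y v)\<^sup>2))) (at v)"
          by (auto intro!: derivative_eq_intros y y' simp: algebra_simps power2_eq_square)
        moreover have "- (2 * v * (y v)\<^sup>2) \<le> 0" using T0 v by simp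
        ultimately show "\<exists>d. ((\<lambda>v. (y' v)\<^sup>2 + (L - v\<^sup>2) * (y v)\<^sup>2) has_real_derivative d) (at v) \<and> d \<le> 0"
          by blast
      qed
      also have "\<dots> \<le> 18 * r\<^sup>2" using before[of T] T0 by (simp add: T2 sr4)
      finally have *: "(y' w)\<^sup>2 + (L - w\<^sup>2) * (y w)\<^sup>2 \<le> 18 * r\<^sup>2" .
      have "w\<^sup>2 \<le> (r ^ 6)\<^sup>2" using that T0 by (intro power_mono) auto
      then have "0 \<le> (L - w\<^sup>2) * (y w)\<^sup>2" by (simp add: r12 flip: power_mult)
      with * have "\<bar>y' w\<bar>\<^sup>2 \<le> 18 * r\<^sup>2" by simp
      then show ?thesis using r1 by (intro 18) auto
    qed
    \<comment> \<open>Factor L - T^2 = (r^6 - T) (r^6 + T) = r^4; the second factor is at least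
      r^6.\<close>
    have w: "u - T \<le> 1 / r\<^sup>2"
    proof -
      have "(r ^ 6 - T) * r ^ 6 \<le> (r ^ 6 - T) * (r ^ 6 + T)"
        using TL T0 by (intro mult_left_mono) auto
      also have "\<dots> = r ^ 4" using T2 by (simp add: r12 algebra_simps power2_eq_square flip: power_add)
      finally have "(r ^ 6 - T) * (r\<^sup>2 * r ^ 4) \<le> 1 * r ^ 4" by (simp flip: power_add)
      then have "(r ^ 6 - T) * r\<^sup>2 \<le> 1" using r1 by (simp only: mult.assoc[symmetric] mult_le_cancel_right) (smt (verit) zero_less_power)
      then have "r ^ 6 - T \<le> 1 / r\<^sup>2" using r1 by (simp add: field_simps)
      then show ?thesis using that by linarith
    qed
    have "\<bar>y u - y T\<bar> \<le> 9/2 * r * (u - T)"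
    proof (cases "T < u")
      case True
      then obtain z where "T < z" "z < u" "y u - y T = (u - T) * y' z"
        using MVT2[of T u y y'] y by blast
      then show ?thesis using E[of z] that
        by (simp add: abs_mult mult.commute mult_right_mono)
    qed (use that in simp)
    also have "\<dots> \<le> 9/2 * r * (1 / r\<^sup>2)" using w r1 by (intro mult_left_mono) auto
    also have "\<dots> = 9/2 * (1 / r)" using r1 by (simp add: power2_eq_square)
    finally show ?thesis using b1[of T] T0 by linarith
  qed
  have b3: "\<bar>y u\<bar> \<le> 9 * (1 / r)" if "r ^ 6 \<le> u" for u
  proof -
    \<comment> \<open>Squaring makes the sign of y irrelevant: the second derivative of y^2 is 2
      (y'^2 + (t^2 - L) y^2), nonnegative beyond r^6.\<close>
    have "(y u)\<^sup>2 \<le> (y (r ^ 6))\<^sup>2"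
    proof (rule convex_tendsto_0_imp_nonincreasing[where f = "\<lambda>t. (y t)\<^sup>2", OF _ _ _ _ that])
      show "((\<lambda>t. (y t)\<^sup>2) has_real_derivative (2 * (y t * y' t))) (at t)" for t
        by (auto intro!: derivative_eq_intros y)
      show "((\<lambda>t. 2 * (y t * y' t)) has_real_derivative
          (2 * ((y' t)\<^sup>2 + (t\<^sup>2 - L) * (y t)\<^sup>2))) (at t)" for t
        by (auto intro!: derivative_eq_intros y y' simp: power2_eq_square algebra_simps)
      show "0 \<le> 2 * ((y' t)\<^sup>2 + (t\<^sup>2 - L) * (y t)\<^sup>2)" if "r ^ 6 \<le> t" for t
      proof -
        have "(r ^ 6)\<^sup>2 \<le> t\<^sup>2" using that r1 by (intro power_mono) auto
        then show ?thesis by (simp add: r12 flip: power_mult)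
      qed
      show "((\<lambda>t. (y t)\<^sup>2) \<longlongrightarrow> 0) at_top" using tendsto_power[OF lim, of 2] by simp
    qed
    then have "\<bar>y u\<bar> \<le> \<bar>y (r ^ 6)\<bar>" by (simp add: abs_le_square_iff)
    also have "\<dots> \<le> 9 * (1 / r)" using b2[of "r ^ 6"] TL by simp
    finally show ?thesis .
  qed
  have "\<bar>y t\<bar> \<le> 9 * (1 / r)"
  proof (cases "t \<le> T")
    case True
    then have "\<bar>y t\<bar> \<le> 9/2 * (1 / r)" using b1 t by blast
    also have "\<dots> \<le> 9 * (1 / r)" using r1 by (intro mult_right_mono) auto
    finally show ?thesis .
  next
    case False
    then show ?thesis using b2[of t] b3[of t] by linarith
  qed
  then show ?thesis by (simp only: rinv)
qed

section \<open>Hermite functions\<close>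

text \<open>The monic (probabilists') Hermite polynomials. The recurrence is what differentiating
  p(t) exp(- t^2 / 2) does to p, up to sign.\<close>

fun He :: "nat \<Rightarrow> real poly" where
  "He 0 = 1"
| "He (Suc k) = [:0, 1:] * He k - pderiv (He k)"

text \<open>The lowering relation. Differentiating the recurrence and inserting the induction
  hypothesis reproduces the recurrence itself, k + 1 times, next to one extra copy of
  \<open>He (Suc k)\<close>.\<close>

lemma pderiv_He_Suc: "pderiv (He (Suc k)) = smult (real (Suc k)) (He k)"
proof (induction k)
  case 0
  then show ?case by (simp add: pderiv_pCons)
next
  case (Suc k)
  have "pderiv (He (Suc (Suc k))) = He (Suc k) + [:0, 1:] * pderiv (He (Suc k)) - pderiv (pderiv (He (Suc k)))"
    by (simp add: pderiv_mult pderiv_diff pderiv_pCons)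
  also have "\<dots> = He (Suc k) + smult (real (Suc k)) ([:0, 1:] * He k - pderiv (He k))"
    unfolding Suc by (simp add: pderiv_smult smult_diff_right del: He.simps)
  also have "\<dots> = smult (real (Suc (Suc k))) (He (Suc k))"
    unfolding He.simps(2)[symmetric] of_nat_Suc[of "Suc k"] smult_add_left by simp
  finally show ?case .
qed

text \<open>Hermite's differential equation: the derivative of \<open>He (Suc k)\<close> is computed
  once by the recurrence and once by the lowering relation.\<close>

lemma He_ode: "pderiv (pderiv (He k)) = [:0, 1:] * pderiv (He k) - smult (real k) (He k)"
proof -
  have "smult (real (Suc k)) (He k) = He k + [:0, 1:] * pderiv (He k) - pderiv (pderiv (He k))"
    unfolding pderiv_He_Suc[symmetric]
    by (simp add: pderiv_mult pderiv_diff pderiv_pCons)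
  then show ?thesis by (simp add: smult_add_left algebra_simps)
qed

lemma iterated_deriv_gaussian:
  "(deriv ^^ k) (\<lambda>s::real. exp (- s\<^sup>2 / 2)) = (\<lambda>t. (-1) ^ k * poly (He k) t * exp (- t\<^sup>2 / 2))"
proof (induction k)
  case (Suc k)
  show ?case
    unfolding funpow.simps o_def Suc
    by (intro ext DERIV_imp_deriv)
       (auto intro!: derivative_eq_intros poly_DERIV simp: algebra_simps)
qed simp

lemma hermite_eq_He: "hermite k t = poly (He k) t"
proof -
  have "(- 1) ^ k * (- 1) ^ k = (1::real)" and "exp (t\<^sup>2 / 2) * exp (- t\<^sup>2 / 2) = 1"
    by (simp_all flip: power_mult_distrib exp_add)
  then have "((- 1) ^ k * (- 1) ^ k) * (exp (t\<^sup>2 / 2) * exp (- t\<^sup>2 / 2)) * poly (He k) t = poly (He k) t"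
    by simp
  then show ?thesis
    unfolding hermite_def iterated_deriv_gaussian by (simp only: mult_ac)
qed

text \<open>Recurrence and lowering relation give He_{n+2}(0) = - (n + 1) He_n(0), so two steps
  multiply the left side by (n + 1) / (n + 2). The right side survives this because (n + 1) (n + 3)
  \<le> (n + 2)^2.\<close>

lemma He_at_zero: "(poly (He n) 0)\<^sup>2 / fact n \<le> 1 / sqrt (real n + 1)"
proof (induction n rule: induct_nat_012)
  case (ge2 n)
  have r: "poly (He (Suc (Suc n))) 0 = - (real n + 1) * poly (He n) 0"
    using arg_cong[OF pderiv_He_Suc, of "\<lambda>p. poly p 0" n]
    by (simp del: He.simps add: He.simps(2)[of "Suc n"] algebra_simps)
  have "(poly (He (Suc (Suc n))) 0)\<^sup>2 / fact (Suc (Suc n))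
      = (real n + 1) / (real n + 2) * ((poly (He n) 0)\<^sup>2 / fact n)"
  proof -
    have "(- (real n + 1) * p)\<^sup>2 / ((real n + 2) * ((real n + 1) * f)) = (real n + 1) / (real n + 2) * (p\<^sup>2 / f)"
      if "f > 0" for p f :: real
    proof -
      have "(- (real n + 1) * p)\<^sup>2 = (real n + 1) * ((real n + 1) * p\<^sup>2)"
        by (simp add: power2_eq_square algebra_simps)
      then show ?thesis using that by (simp add: frac_eq_eq)
    qed
    from this[of "fact n"] show ?thesis unfolding r by (simp add: add.commute)
  qed
  also have "\<dots> \<le> (real n + 1) / (real n + 2) * (1 / sqrt (real n + 1))"
    by (intro mult_left_mono ge2) auto
  also have "\<dots> = (real n + 1) / sqrt (real n + 1) / (real n + 2)"
    by simp
  also have "\<dots> = sqrt (real n + 1) / (real n + 2)"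
    by (subst real_div_sqrt) auto
  also have "\<dots> \<le> 1 / sqrt (real (Suc (Suc n)) + 1)"
  proof -
    have "sqrt ((real n + 1) * (real n + 3)) \<le> real n + 2"
      by (rule real_le_lsqrt) (auto simp: power2_eq_square algebra_simps)
    then have "sqrt (real n + 1) * sqrt (real n + 3) \<le> real n + 2"
      unfolding real_sqrt_mult .
    then show ?thesis
      by (simp add: field_simps)
  qed
  finally show ?case .
qed auto

text \<open>The scale \<open>a\<close> may be negative, which covers the decay at both ends of the
  line. From t = 2 on the Gaussian lies below exp(- t).\<close>

lemma poly_times_gaussian_tendsto_0:
  "((\<lambda>t::real. poly p (a * t) * exp (- t\<^sup>2 / 2)) \<longlongrightarrow> 0) at_top"
proof -
  have pow: "((\<lambda>t::real. t ^ k * exp (- t\<^sup>2 / 2)) \<longlongrightarrow> 0) at_top" for k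
  proof (rule tendsto_sandwich)
    show "\<forall>\<^sub>F t::real in at_top. 0 \<le> t ^ k * exp (- t\<^sup>2 / 2)"
      using eventually_ge_at_top[of 0] by eventually_elim auto
    show "\<forall>\<^sub>F t::real in at_top. t ^ k * exp (- t\<^sup>2 / 2) \<le> t ^ k / exp t"
      using eventually_ge_at_top[of 2]
    proof eventually_elim
      case (elim t)
      then have "2 * t \<le> t\<^sup>2" by (simp add: power2_eq_square)
      then have "exp (- t\<^sup>2 / 2) \<le> exp (- t)" by simp
      then have "t ^ k * exp (- t\<^sup>2 / 2) \<le> t ^ k * exp (- t)"
        using elim by (intro mult_left_mono) auto
      also have "\<dots> = t ^ k / exp t"
        by (simp only: exp_minus divide_inverse)
      finally show ?case .
    qed
  qed (auto intro: tendsto_power_div_exp_0)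
  have "((\<lambda>t. \<Sum>i\<le>degree p. coeff p i * a ^ i * (t ^ i * exp (- t\<^sup>2 / 2))) \<longlongrightarrow> 0) at_top"
    by (rule tendsto_null_sum, rule tendsto_mult_right_zero, rule pow)
  then show ?thesis
    by (simp add: poly_altdef sum_distrib_right power_mult_distrib mult.assoc)
qed

section \<open>Hermite functions as oscillators: equation, initial energy, uniform bounds\<close>

definition xi' :: "nat \<Rightarrow> real \<Rightarrow> real" where
  "xi' m t = pi powr (-1/4) * fact (m - 1) powr (-1/2) * exp (- t\<^sup>2 / 2) *
     (sqrt 2 * poly (pderiv (He (m - 1))) (sqrt 2 * t) - t * poly (He (m - 1)) (sqrt 2 * t))"

lemma xi_eq: "xi m t = pi powr (-1/4) * fact (m - 1) powr (-1/2) * exp (- t\<^sup>2 / 2) * poly (He (m - 1)) (sqrt 2 * t)"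
  by (simp add: xi_def hermite_eq_He)

lemma poly_scaled_DERIV:
  "((\<lambda>t. poly p (a * t)) has_real_derivative (a * poly (pderiv p) (a * t))) (at t)"
  using DERIV_chain2[OF poly_DERIV, of "\<lambda>t. a * t" a t UNIV p]
  by (auto intro!: derivative_eq_intros simp: mult.commute)

lemma DERIV_xi: "(xi m has_real_derivative xi' m t) (at t)"
  unfolding xi_eq[abs_def] xi'_def
  by (auto intro!: derivative_eq_intros poly_scaled_DERIV simp: algebra_simps)

text \<open>The eigenvalue 2 m - 1 is 2 (m - 1) from Hermite's equation at sqrt 2 * t, plus 1 from
  the product rule for t times the polynomial.\<close>

lemma DERIV_xi':
  assumes "1 \<le> m"
  shows "(xi' m has_real_derivative (t\<^sup>2 - (2 * real m - 1)) * xi m t) (at t)"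
proof -
  define p where "p = He (m - 1)"
  define c where "c = pi powr (-1/4) * fact (m - 1) powr (-1/2)"
  have ode: "poly (pderiv (pderiv p)) (sqrt 2 * t) =
      sqrt 2 * t * poly (pderiv p) (sqrt 2 * t) - (real m - 1) * poly p (sqrt 2 * t)"
    unfolding p_def He_ode using assms by simp
  have s2: "sqrt 2 * (sqrt 2 * y) = 2 * y" for y :: real
    by (simp flip: mult.assoc)
  have "((\<lambda>t. c * exp (- t\<^sup>2 / 2) * (sqrt 2 * poly (pderiv p) (sqrt 2 * t) - t * poly p (sqrt 2 * t)))
     has_real_derivative c * (- t * exp (- t\<^sup>2 / 2)) * (sqrt 2 * poly (pderiv p) (sqrt 2 * t) - t * poly p (sqrt 2 * t)) +
     c * exp (- t\<^sup>2 / 2) * (sqrt 2 * (sqrt 2 * poly (pderiv (pderiv p)) (sqrt 2 * t))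
        - (poly p (sqrt 2 * t) + t * (sqrt 2 * poly (pderiv p) (sqrt 2 * t))))) (at t)"
    by (auto intro!: derivative_eq_intros poly_scaled_DERIV)
  also have "c * (- t * exp (- t\<^sup>2 / 2)) * (sqrt 2 * poly (pderiv p) (sqrt 2 * t) - t * poly p (sqrt 2 * t)) +
     c * exp (- t\<^sup>2 / 2) * (sqrt 2 * (sqrt 2 * poly (pderiv (pderiv p)) (sqrt 2 * t))
        - (poly p (sqrt 2 * t) + t * (sqrt 2 * poly (pderiv p) (sqrt 2 * t))))
     = (t\<^sup>2 - (2 * real m - 1)) * xi m t"
    unfolding s2 ode xi_eq c_def[symmetric] p_def[symmetric]
    by (simp add: algebra_simps power2_eq_square)
  finally show ?thesis
    unfolding xi'_def[abs_def] c_def[symmetric] p_def[symmetric] .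
qed

lemma xi_tendsto_0: "(xi m \<longlongrightarrow> 0) at_top" "((\<lambda>t. xi m (- t)) \<longlongrightarrow> 0) at_top"
proof -
  have "((\<lambda>t. c * (poly (He k) (a * t) * exp (- t\<^sup>2 / 2))) \<longlongrightarrow> 0) at_top" for k a and c :: real
    by (rule tendsto_mult_right_zero, rule poly_times_gaussian_tendsto_0)
  note * = this[of "pi powr (-1/4) * fact (m - 1) powr (-1/2)" "m - 1"]
  show "(xi m \<longlongrightarrow> 0) at_top"
    using *[of "sqrt 2"] by (simp add: xi_eq[abs_def] mult_ac)
  show "((\<lambda>t. xi m (- t)) \<longlongrightarrow> 0) at_top"
    using *[of "- sqrt 2"] by (simp add: xi_eq[abs_def] mult_ac)
qed

text \<open>The initial condition of \<open>oscillator_bound\<close>. Both summands are at most sqrt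
  2 * sqrt (2 m - 1), by \<open>He_at_zero\<close> directly and, for the slope, after the lowering
  relation; and 2 * sqrt 2 \<le> 3.\<close>

lemma xi_energy_at_zero:
  assumes "1 \<le> m"
  shows "(xi' m 0)\<^sup>2 + (2 * real m - 1) * (xi m 0)\<^sup>2 \<le> 3 * sqrt (2 * real m - 1)"
proof -
  obtain n where m: "m = Suc n" using assms by (cases m) auto
  define l where "l = 2 * real n + 1"
  define c where "c = (pi powr (-1/4) * fact n powr (-1/2))\<^sup>2"
  \<comment> \<open>The squared normalization is pi^(-1/2) / n!, and pi > 1.\<close>
  have c: "c \<le> 1 / fact n" "0 \<le> c"
  proof -
    have pi: "(pi powr (-1/4))\<^sup>2 = 1 / sqrt pi"
    proof -
      have "(pi powr (-1/4))\<^sup>2 = pi powr ((-1/4) + (-1/4))"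
        unfolding powr_add power2_eq_square ..
      also have "(-1/4) + (-1/4) = - (1/2 :: real)" by simp
      also have "pi powr - (1/2) = 1 / sqrt pi" by (simp only: powr_minus_divide powr_half_sqrt pi_ge_zero)
      finally show ?thesis .
    qed
    have fact: "(x powr (-1/2))\<^sup>2 = 1 / x" if "0 < x" for x :: real
    proof -
      have "(x powr (-1/2))\<^sup>2 = x powr ((-1/2) + (-1/2))"
        unfolding powr_add power2_eq_square ..
      also have "(-1/2) + (-1/2) = - (1 :: real)" by simp
      also have "x powr - 1 = 1 / x" using that by (simp only: powr_minus_divide powr_one)
      finally show ?thesis .
    qed
    have "c = 1 / sqrt pi * (1 / fact n)"
      unfolding c_def power_mult_distrib pi using fact[of "fact n"] by simp
    also have "\<dots> \<le> 1 * (1 / fact n)" using pi_gt3 by (intro mult_right_mono) auto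
    finally show "c \<le> 1 / fact n" by simp
  qed (simp add: c_def)
  have n1: "sqrt l \<le> sqrt 2 * sqrt (real n + 1)"
    unfolding l_def by (simp add: real_sqrt_mult[symmetric])
  have "l * (xi m 0)\<^sup>2 = l * (c * (poly (He n) 0)\<^sup>2)"
    by (simp add: xi_eq m c_def power_mult_distrib)
  also have "\<dots> \<le> l * (1 / fact n * (poly (He n) 0)\<^sup>2)"
    by (intro mult_left_mono mult_right_mono c) (auto simp: l_def)
  also have "\<dots> \<le> l * (1 / sqrt (real n + 1))"
    using He_at_zero[of n] by (intro mult_left_mono) (auto simp: l_def)
  also have "\<dots> \<le> sqrt 2 * sqrt l"
  proof -
    have "l = sqrt l * sqrt l" by (simp add: l_def)
    also have "\<dots> \<le> sqrt l * (sqrt 2 * sqrt (real n + 1))"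
      by (intro mult_left_mono n1) (simp add: l_def)
    finally show ?thesis by (simp add: field_simps)
  qed
  finally have 1: "l * (xi m 0)\<^sup>2 \<le> sqrt 2 * sqrt l" .
  have 2: "(xi' m 0)\<^sup>2 \<le> sqrt 2 * sqrt l"
  proof (cases n)
    case 0
    then show ?thesis by (simp add: xi'_def m l_def)
  next
    case (Suc k)
    have "(xi' m 0)\<^sup>2 = c * (2 * (poly (pderiv (He n)) 0)\<^sup>2)"
      by (simp add: xi'_def m c_def power_mult_distrib)
    also have "\<dots> \<le> 1 / fact n * (2 * (poly (pderiv (He n)) 0)\<^sup>2)"
      by (intro mult_right_mono c) auto
    also have "\<dots> = 2 * real n * ((poly (He k) 0)\<^sup>2 / fact k)"
    proof -
      have eq: "1 / (N * f) * (2 * (N * p)\<^sup>2) = 2 * N * (p\<^sup>2 / f)" if "0 < N" "0 < f" for N f p :: real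
        using that by (simp add: field_simps power2_eq_square)
      have pd: "poly (pderiv (He n)) 0 = real n * poly (He k) 0"
        unfolding Suc pderiv_He_Suc poly_smult ..
      have fc: "fact n = real n * fact k"
        unfolding Suc fact_Suc ..
      show ?thesis
        unfolding pd fc by (rule eq) (simp_all add: Suc)
    qed
    also have "\<dots> \<le> 2 * real n * (1 / sqrt (real n))"
      using He_at_zero[of k] by (intro mult_left_mono) (auto simp: Suc add.commute)
    also have "\<dots> = 2 * (real n / sqrt (real n))" by simp
    also have "\<dots> = 2 * sqrt (real n)" by (subst real_div_sqrt) auto
    also have "\<dots> = sqrt 2 * sqrt (2 * real n)"
      by (simp add: real_sqrt_mult)
    also have "\<dots> \<le> sqrt 2 * sqrt l"
      by (simp add: l_def)
    finally show ?thesis .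
  qed
  have "2 * sqrt 2 * sqrt l \<le> 3 * sqrt l"
  proof (rule mult_right_mono)
    have "sqrt 2 \<le> 3/2" by (rule real_le_lsqrt) (auto simp: power2_eq_square)
    then show "2 * sqrt 2 \<le> (3::real)" by simp
  qed (simp add: l_def)
  moreover have "2 * real m - 1 = l" by (simp add: l_def m)
  ultimately show ?thesis using 1 2 by simp
qed

lemma xi_bound:
  assumes m: "1 \<le> m"
  shows "\<bar>xi m t\<bar> \<le> 9 * real m powr (-1/12)"
proof -
  define L where "L = 2 * real m - 1"
  have L: "1 \<le> L" "real m \<le> L" using m by (auto simp: L_def)
  have init: "(xi' m 0)\<^sup>2 + L * (xi m 0)\<^sup>2 \<le> 3 * sqrt L"
    using xi_energy_at_zero[OF m] by (simp add: L_def)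
  have ode: "(xi' m has_real_derivative (u\<^sup>2 - L) * xi m u) (at u)" for u
    using DERIV_xi'[OF m] by (simp add: L_def)
  have "\<bar>xi m t\<bar> \<le> 9 * L powr (-1/12)"
  proof (cases "0 \<le> t")
    case True
    then show ?thesis
      using oscillator_bound[OF DERIV_xi ode xi_tendsto_0(1) init L(1)] by blast
  next
    case False
    \<comment> \<open>The coefficient t^2 - L is even, so the reflected function solves the same
      equation with the same initial energy.\<close>
    have "\<bar>xi m (- (- t))\<bar> \<le> 9 * L powr (-1/12)"
    proof (rule oscillator_bound[where y = "\<lambda>u. xi m (- u)" and y' = "\<lambda>u. - xi' m (- u)"])
      show "((\<lambda>u. xi m (- u)) has_real_derivative - xi' m (- u)) (at u)" for u
        using DERIV_xi by (simp only: flip: DERIV_mirror)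
      show "((\<lambda>u. - xi' m (- u)) has_real_derivative (u\<^sup>2 - L) * xi m (- u)) (at u)" for u
        using DERIV_minus[OF DERIV_mirror[THEN iffD1, OF ode]] by simp
    qed (use False init L(1) xi_tendsto_0(2) in simp_all)
    then show ?thesis by simp
  qed
  also have "\<dots> \<le> 9 * real m powr (-1/12)"
    using L m by (intro mult_left_mono powr_mono2') auto
  finally show ?thesis .
qed

lemma xi_uniform_bound:
  assumes "1 \<le> m"
  shows "\<bar>xi m t\<bar> \<le> 9"
proof -
  have "real m powr (-1/12) \<le> 1"
    using powr_mono[of "-1/12" 0 "real m"] assms by simp
  with xi_bound[OF assms, of t] show ?thesis by linarith
qed

text \<open>Each of the n factors of the tensor product is at most 9 in absolute value, which gives
  a bound independent of i and x.\<close>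

lemma hermite_enumeration_bound:
  fixes e :: "nat \<Rightarrow> real ^ 'n::finite \<Rightarrow> real"
  assumes "hermite_enumeration e" "1 \<le> i"
  shows "(e i x)\<^sup>2 \<le> (9 ^ CARD('n))\<^sup>2"
proof -
  obtain b where b: "bij_betw b {1..} {\<beta>. \<forall>k::'n. 1 \<le> \<beta> k}" and e: "e i = hermite_tensor (b i)"
    using assms unfolding hermite_enumeration_def by blast
  have "1 \<le> b i k" for k
    using bij_betwE[OF b] assms(2) by auto
  then have "\<bar>e i x\<bar> \<le> (\<Prod>k\<in>(UNIV::'n set). 9)"
    unfolding e hermite_tensor_def abs_prod by (intro prod_mono) (auto intro: xi_uniform_bound)
  then show ?thesis
    using power_mono[of "\<bar>e i x\<bar>" "9 ^ CARD('n)" 2] by simp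
qed

section \<open>Multi-indices of length one\<close>

text \<open>\<open>kappa\<close> runs through the antidiagonals i + j = s. The offset
  \<open>T s\<close> counts the pairs with smaller sum, and the antidiagonal has s - 1 members, so
  different antidiagonals get disjoint ranges of values; on a fixed one, \<open>j\<close> is read
  off.\<close>

lemma kappa_inj_on: "inj_on (\<lambda>(i, j). kappa i j) ({1..} \<times> {1..})"
proof -
  define T where "T s = (s - 2) * (s - 1) div 2" for s :: nat
  have T_Suc: "T (Suc s) = T s + (s - 1)" if "1 \<le> s" for s
  proof (cases "s = 1")
    case False
    \<comment> \<open>The shift removes truncated subtraction, and the increment 2 (r + 1) is even,
      so halving commutes with adding it.\<close>
    define r where "r = s - 2"
    have s: "s = r + 2" using that False by (simp add: r_def)
    have "(r + 1) * (r + 2) = r * (r + 1) + 2 * (r + 1)" by (simp add: algebra_simps)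
    then have "(r + 1) * (r + 2) div 2 = r * (r + 1) div 2 + (r + 1)"
      by (simp only: div_mult_self2)
    then show ?thesis by (simp add: T_def s)
  qed (simp add: T_def)
  have T_mono: "T s \<le> T u" if "s \<le> u" for s u
    unfolding T_def using that by (intro div_le_mono mult_le_mono) auto
  have less: "kappa i j < kappa i' j'"
    if "1 \<le> i" "1 \<le> j" "1 \<le> i'" "1 \<le> j'" "i + j < i' + j'" for i j i' j'
  proof -
    have "kappa i j \<le> T (Suc (i + j))"
    proof -
      have "kappa i j \<le> T (i + j) + (i + j - 1)"
        unfolding kappa_def T_def using that by linarith
      also have "\<dots> = T (Suc (i + j))" using T_Suc[of "i + j"] that by simp
      finally show ?thesis .
    qed
    also have "\<dots> \<le> T (i' + j')" using that by (intro T_mono) auto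
    also have "\<dots> < kappa i' j'" using that by (simp add: kappa_def T_def)
    finally show ?thesis .
  qed
  show ?thesis
  proof (rule inj_onI, clarsimp)
    fix i j i' j' :: nat
    assume *: "Suc 0 \<le> i" "Suc 0 \<le> j" "Suc 0 \<le> i'" "Suc 0 \<le> j'" and eq: "kappa i j = kappa i' j'"
    have "i + j = i' + j'"
      using less[of i j i' j'] less[of i' j' i j] * eq
      by (cases "i + j" "i' + j'" rule: linorder_cases) auto
    moreover from this eq have "j = j'" by (simp add: kappa_def)
    ultimately show "i = i' \<and> j = j'" by simp
  qed
qed

lemma kappa_ge:
  assumes "1 \<le> i" "1 \<le> j"
  shows "i \<le> kappa i j" "j \<le> kappa i j" "1 \<le> kappa i j"
proof -
  show "i \<le> kappa i j"
  proof (cases "i + j = 2")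
    case False
    \<comment> \<open>The offset (r + 1) (r + 2) / 2 is at least r + 1 = i + j - 2, and
      \<open>j\<close> adds at least 1. The pair (1, 1) is treated apart because r would be
      truncated there.\<close>
    define r where "r = i + j - 3"
    have r: "i + j = r + 3" using assms False by (simp add: r_def)
    have "2 * (r + 1) \<le> (r + 1) * (r + 2)" by simp
    then have "2 * (r + 1) div 2 \<le> (r + 1) * (r + 2) div 2" by (rule div_le_mono)
    then have "r + 1 \<le> (r + 1) * (r + 2) div 2" by simp
    then show ?thesis using r assms by (simp add: kappa_def)
  qed (use assms in \<open>simp add: kappa_def\<close>)
  show "j \<le> kappa i j" by (simp add: kappa_def)
  then show "1 \<le> kappa i j" using assms by simp
qed

lemma kappa_one:
  assumes "1 \<le> i"
  shows "real (kappa i 1) = 1 + (real i - 1) * real i / 2"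
proof -
  obtain n where i: "i = Suc n" using assms by (cases i) auto
  \<comment> \<open>The integer division is exact, as n (n + 1) is even.\<close>
  have "real (n * (n + 1) div 2) = real (n * (n + 1)) / real 2"
    by (rule real_of_nat_div) simp
  then show ?thesis by (simp add: kappa_def i algebra_simps)
qed

section \<open>Unit multi-indices and the coefficients of the two noises\<close>

lemma mi_unit_inject: "mi_unit k = mi_unit l \<longleftrightarrow> k = l"
  unfolding mi_unit_def by (metis zero_neq_one)

lemma support_mi_unit: "{l. mi_unit k l \<noteq> 0} = {k}"
  by (auto simp: mi_unit_def)

lemma mi_fact_unit: "mi_fact (mi_unit k) = 1"
  unfolding mi_fact_def support_mi_unit by (simp add: mi_unit_def)

lemma two_N_unit: "two_N q (mi_unit k) = (2 * real k) powi q"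
  unfolding two_N_def support_mi_unit by (simp add: mi_unit_def)

lemma mi_unit_in_multi_indices: "1 \<le> k \<Longrightarrow> mi_unit k \<in> multi_indices"
  using support_mi_unit[of k] by (simp add: multi_indices_def mi_unit_def)

lemma mi_unit2_inj_on: "inj_on (\<lambda>(i, j). mi_unit2 i j) ({1..} \<times> {1..})"
  using kappa_inj_on unfolding inj_on_def mi_unit2_def case_prod_beta mi_unit_inject .

text \<open>Provides the uniqueness that the \<open>THE\<close> descriptions in both coefficient
  functions rely on.\<close>

lemma mi_unit2_eq_iff:
  assumes "1 \<le> i" "1 \<le> j" "1 \<le> i'" "1 \<le> j'"
  shows "mi_unit2 i j = mi_unit2 i' j' \<longleftrightarrow> i = i' \<and> j = j'"
  using inj_onD[OF mi_unit2_inj_on, of "(i, j)" "(i', j')"] assms by auto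

lemma levy_noise_coeff_unit:
  assumes "1 \<le> i"
  shows "levy_noise_coeff \<nu> e x (mi_unit2 i 1) = m2 \<nu> * e i x"
proof -
  have "(THE k. 1 \<le> k \<and> mi_unit2 i 1 = mi_unit2 k 1) = i"
    using assms by (intro the_equality) (auto simp: mi_unit2_eq_iff)
  then show ?thesis using assms by (auto simp: levy_noise_coeff_def)
qed

lemma poisson_noise_coeff_unit:
  assumes "1 \<le> i" "1 \<le> j"
  shows "poisson_noise_coeff \<nu> e x z (mi_unit2 i j) = e i x * levy_poly \<nu> j z"
proof -
  have "(THE (k, l). 1 \<le> k \<and> 1 \<le> l \<and> mi_unit2 i j = mi_unit2 k l) = (i, j)"
    using assms by (intro the_equality) (auto simp: mi_unit2_eq_iff)
  then show ?thesis using assms by (auto simp: poisson_noise_coeff_def)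
qed

lemma weight_unit2:
  "mi_fact (mi_unit2 i j) * two_N (- int q) (mi_unit2 i j) = 2 powi (- int q) * real (kappa i j) powi (- int q)"
  by (simp add: mi_unit2_def mi_fact_unit two_N_unit power_int_mult_distrib)

section \<open>Unconditional sums: reindexing, inverse squares, products\<close>

lemma summable_infsum_supported_on_image:
  fixes f :: "'a \<Rightarrow> real"
  assumes "inj_on g B" "g ` B \<subseteq> A" "\<And>a. a \<in> A \<Longrightarrow> a \<notin> g ` B \<Longrightarrow> f a = 0"
  shows "f summable_on A \<longleftrightarrow> (\<lambda>b. f (g b)) summable_on B"
    and "infsum f A = (\<Sum>\<^sub>\<infinity>b\<in>B. f (g b))"
proof -
  have "f summable_on A \<longleftrightarrow> f summable_on (g ` B)"
    using assms by (intro summable_on_cong_neutral) auto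
  then show "f summable_on A \<longleftrightarrow> (\<lambda>b. f (g b)) summable_on B"
    using summable_on_reindex[OF assms(1), of f] by (simp add: o_def)
  have "infsum f A = infsum f (g ` B)"
    using assms by (intro infsum_cong_neutral) auto
  then show "infsum f A = (\<Sum>\<^sub>\<infinity>b\<in>B. f (g b))"
    using infsum_reindex[OF assms(1), of f] by (simp add: o_def)
qed

lemma levy_noise_coeff_outside:
  "\<alpha> \<notin> (\<lambda>i. mi_unit2 i 1) ` {1..} \<Longrightarrow> levy_noise_coeff \<nu> e x \<alpha> = 0"
  by (auto simp: levy_noise_coeff_def)

lemma poisson_noise_coeff_outside:
  "\<alpha> \<notin> (\<lambda>(i, j). mi_unit2 i j) ` ({1..} \<times> {1..}) \<Longrightarrow> poisson_noise_coeff \<nu> e x z \<alpha> = 0"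
  by (force simp: poisson_noise_coeff_def)

lemma summable_on_inverse_squares: "(\<lambda>i. 1 / (real i)\<^sup>2) summable_on {1..}"
proof -
  have "summable (\<lambda>i. 1 / (real i)\<^sup>2)"
    using inverse_power_summable[of 2, where 'a = real] by (simp add: divide_inverse)
  then have "(\<lambda>i. 1 / (real i)\<^sup>2) summable_on UNIV"
    by (subst summable_on_UNIV_nonneg_real_iff) auto
  then show ?thesis by (rule summable_on_subset_banach) auto
qed

text \<open>A finite set of pairs lies in the rectangle of its two projections, where the sum
  factors and is bounded by the product of the total sums.\<close>

lemma summable_on_Times_nonneg:
  fixes f :: "'a \<Rightarrow> real" and g :: "'b \<Rightarrow> real"
  assumes "f summable_on A" "g summable_on B"
    and "\<And>a. a \<in> A \<Longrightarrow> 0 \<le> f a" "\<And>b. b \<in> B \<Longrightarrow> 0 \<le> g b"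
  shows "(\<lambda>(a, b). f a * g b) summable_on A \<times> B"
proof (rule nonneg_bdd_above_summable_on)
  show "bdd_above (sum (\<lambda>(a, b). f a * g b) ` {F. F \<subseteq> A \<times> B \<and> finite F})"
  proof (rule bdd_aboveI2)
    fix F assume "F \<in> {F. F \<subseteq> A \<times> B \<and> finite F}"
    then have F: "F \<subseteq> A \<times> B" "finite F" by auto
    have s: "fst ` F \<subseteq> A" "snd ` F \<subseteq> B" "finite (fst ` F)" "finite (snd ` F)" using F by auto
    have "(\<Sum>(a, b)\<in>F. f a * g b) \<le> (\<Sum>(a, b)\<in>fst ` F \<times> snd ` F. f a * g b)"
      using s assms(3,4) by (intro sum_mono2) (auto simp: subset_fst_snd intro!: mult_nonneg_nonneg)
    also have "\<dots> = sum f (fst ` F) * sum g (snd ` F)"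
      by (simp add: sum_product sum.cartesian_product)
    also have "\<dots> \<le> infsum f A * infsum g B"
      using s assms by (intro mult_mono finite_sum_le_infsum infsum_nonneg sum_nonneg) auto
    finally show "(\<Sum>(a, b)\<in>F. f a * g b) \<le> infsum f A * infsum g B" .
  qed
qed (use assms in auto)

section \<open>Expansions of the noises\<close>

text \<open>Since \<open>kappa i 1\<close> is at least i, an exponent q \<ge> 2 makes the terms at
  most D / i^2.\<close>

lemma levy_noise_summable:
  assumes bdd: "\<And>i. 1 \<le> i \<Longrightarrow> (e i x)\<^sup>2 \<le> D" and q: "2 \<le> q"
  shows "(\<lambda>i. (e i x)\<^sup>2 * 2 powi (- int q) * real (kappa i 1) powi (- int q)) summable_on {1..}"
proof (rule summable_on_comparison_test)
  show "(\<lambda>i. D * (1 / (real i)\<^sup>2)) summable_on {1..}"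
    by (intro summable_on_cmult_right summable_on_inverse_squares)
  fix i :: nat assume "i \<in> {1..}"
  then have i: "1 \<le> i" by simp
  have "(2::real) powi (- int q) \<le> 1"
    by (simp add: power_int_minus inverse_le_1_iff)
  moreover have "real (kappa i 1) powi (- int q) \<le> 1 / (real i)\<^sup>2"
  proof -
    have "(real i)\<^sup>2 \<le> (real (kappa i 1))\<^sup>2" using kappa_ge[of i 1] i by (intro power_mono) auto
    also have "\<dots> \<le> real (kappa i 1) ^ q" using kappa_ge[of i 1] i q by (intro power_increasing) auto
    finally have "1 / real (kappa i 1) ^ q \<le> 1 / (real i)\<^sup>2"
      using i kappa_ge(3)[of i 1] by (intro divide_left_mono) auto
    then show ?thesis by (simp add: power_int_minus divide_inverse)
  qed
  ultimately have "((e i x)\<^sup>2 * 2 powi (- int q)) * real (kappa i 1) powi (- int q) \<le> (D * 1) * (1 / (real i)\<^sup>2)"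
    using bdd[OF i] by (intro mult_mono) (auto intro: order_trans[OF zero_le_power2])
  then show "(e i x)\<^sup>2 * 2 powi (- int q) * real (kappa i 1) powi (- int q) \<le> D * (1 / (real i)\<^sup>2)"
    by simp
qed simp

text \<open>The exponent 4 is spent in halves: \<open>kappa i j\<close> dominates both i and j, so
  the weight is at most 1 / (i^2 j^2). The double series then splits into the inverse squares and
  the weighted squares of the polynomials at \<open>z\<close>.\<close>

lemma poisson_noise_summable:
  assumes bdd: "\<And>i. 1 \<le> i \<Longrightarrow> (e i x)\<^sup>2 \<le> D"
    and p: "(\<lambda>j. (levy_poly \<nu> j z)\<^sup>2 / (real j)\<^sup>2) summable_on {1..}"
  shows "(\<lambda>\<alpha>. (poisson_noise_coeff \<nu> e x z \<alpha>)\<^sup>2 * mi_fact \<alpha> * two_N (- int 4) \<alpha>) summable_on multi_indices"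
proof -
  let ?p = "levy_poly \<nu>"
  have D: "0 \<le> D" using bdd[of 1] by (intro order_trans[OF zero_le_power2]) auto
  have "(\<lambda>(i, j). D * (1 / (real i)\<^sup>2) * ((?p j z)\<^sup>2 / (real j)\<^sup>2)) summable_on {1..} \<times> {1..}"
    using D by (intro summable_on_Times_nonneg summable_on_cmult_right summable_on_inverse_squares p) auto
  then have "(\<lambda>(i, j). (e i x * ?p j z)\<^sup>2 * (2 powi (- int 4) * real (kappa i j) powi (- int 4)))
      summable_on {1..} \<times> {1..}"
  proof (rule summable_on_comparison_test, goal_cases)
    case (1 b)
    then obtain i j where b: "b = (i, j)" and ij: "1 \<le> i" "1 \<le> j" by auto
    define k where "k = real (kappa i j)"
    have k: "real i \<le> k" "real j \<le> k" using kappa_ge[OF ij] by (auto simp: k_def)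
    have "(real i)\<^sup>2 * (real j)\<^sup>2 \<le> k\<^sup>2 * k\<^sup>2"
      using k by (intro mult_mono power_mono) auto
    also have "\<dots> = k ^ 4" by (simp flip: power_add)
    also have "\<dots> \<le> 16 * k ^ 4" by simp
    finally have "1 / (16 * k ^ 4) \<le> 1 / ((real i)\<^sup>2 * (real j)\<^sup>2)"
      using ij k by (intro divide_left_mono) auto
    then have "(e i x)\<^sup>2 * (?p j z)\<^sup>2 * (1 / (16 * k ^ 4)) \<le> D * (?p j z)\<^sup>2 * (1 / ((real i)\<^sup>2 * (real j)\<^sup>2))"
      using bdd[OF ij(1)] D by (intro mult_mono) auto
    moreover have "D * (?p j z)\<^sup>2 * (1 / ((real i)\<^sup>2 * (real j)\<^sup>2)) = D * (1 / (real i)\<^sup>2) * ((?p j z)\<^sup>2 / (real j)\<^sup>2)"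
      by simp
    moreover have "2 powi (- int 4) * k powi (- int 4) = 1 / (16 * k ^ 4)"
      unfolding power_int_minus power_int_of_nat
      by (simp only: divide_inverse inverse_mult_distrib) simp
    ultimately show ?case
      unfolding b prod.case k_def[symmetric] power_mult_distrib by (simp only:)
  next
    case (2 b)
    then show ?case by (cases b) simp
  qed
  moreover define f where "f \<alpha> = (poisson_noise_coeff \<nu> e x z \<alpha>)\<^sup>2 * mi_fact \<alpha> * two_N (- int 4) \<alpha>" for \<alpha>
  \<comment> \<open>From here on the sum over pairs is moved to multi-indices: \<open>f\<close>
    vanishes off the injective image of the pairs.\<close>
  have "(\<lambda>b. f (case b of (i, j) \<Rightarrow> mi_unit2 i j)) summable_on {1..} \<times> {1..} \<longleftrightarrow>
      (\<lambda>(i, j). (e i x * ?p j z)\<^sup>2 * (2 powi (- int 4) * real (kappa i j) powi (- int 4)))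
        summable_on {1..} \<times> {1..}"
  proof (rule summable_on_cong)
    fix b :: "nat \<times> nat" assume "b \<in> {1..} \<times> {1..}"
    then obtain i j where b: "b = (i, j)" and ij: "1 \<le> i" "1 \<le> j" by auto
    show "f (case b of (i, j) \<Rightarrow> mi_unit2 i j) =
        (case b of (i, j) \<Rightarrow> (e i x * ?p j z)\<^sup>2 * (2 powi (- int 4) * real (kappa i j) powi (- int 4)))"
      unfolding f_def b prod.case poisson_noise_coeff_unit[OF ij] mult.assoc weight_unit2 ..
  qed
  moreover have "(\<lambda>(i, j). mi_unit2 i j) ` ({1..} \<times> {1..}) \<subseteq> multi_indices"
    using kappa_ge(3) by (auto simp: mi_unit2_def intro!: mi_unit_in_multi_indices)
  moreover have "f \<alpha> = 0" if "\<alpha> \<notin> (\<lambda>(i, j). mi_unit2 i j) ` ({1..} \<times> {1..})" for \<alpha>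
    unfolding f_def poisson_noise_coeff_outside[OF that] by simp
  ultimately have "f summable_on multi_indices"
    using summable_infsum_supported_on_image(1)[OF mi_unit2_inj_on, of multi_indices f] by blast
  then show ?thesis unfolding f_def .
qed

text \<open>Only the multi-indices \<epsilon>^(i,1) carry a coefficient; there the factorial is 1
  and the weight is that of the single entry \<open>kappa i 1\<close>.\<close>

lemma levy_noise_reindex:
  fixes \<nu> and e :: "nat \<Rightarrow> real ^ 'n::finite \<Rightarrow> real" and x
  defines "f \<equiv> \<lambda>q \<alpha>. (levy_noise_coeff \<nu> e x \<alpha>)\<^sup>2 * mi_fact \<alpha> * two_N (- int q) \<alpha>"
    and "g \<equiv> \<lambda>q i. (e i x)\<^sup>2 * 2 powi (- int q) * real (kappa i 1) powi (- int q)"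
  assumes g: "g q summable_on {1..}"
  shows "f q summable_on multi_indices" "infsum (f q) multi_indices = (m2 \<nu>)\<^sup>2 * infsum (g q) {1..}"
proof -
  have inj: "inj_on (\<lambda>i. mi_unit2 i 1) {1..}"
    by (auto simp: inj_on_def mi_unit2_eq_iff)
  have sub: "(\<lambda>i. mi_unit2 i 1) ` {1..} \<subseteq> multi_indices"
    using kappa_ge(3) by (auto simp: mi_unit2_def intro!: mi_unit_in_multi_indices)
  have out: "f q \<alpha> = 0" if "\<alpha> \<notin> (\<lambda>i. mi_unit2 i 1) ` {1..}" for \<alpha>
    using levy_noise_coeff_outside[OF that, of \<nu> e x] by (simp add: f_def)
  have fg: "f q (mi_unit2 i 1) = (m2 \<nu>)\<^sup>2 * g q i" if "i \<in> {1..}" for i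
  proof -
    have "f q (mi_unit2 i 1) = (m2 \<nu> * e i x)\<^sup>2 * (mi_fact (mi_unit2 i 1) * two_N (- int q) (mi_unit2 i 1))"
      using levy_noise_coeff_unit[of i \<nu> e x] that by (simp add: f_def)
    then show ?thesis by (simp only: weight_unit2) (simp add: g_def power_mult_distrib)
  qed
  have "(\<lambda>i. f q (mi_unit2 i 1)) summable_on {1..} \<longleftrightarrow> (\<lambda>i. (m2 \<nu>)\<^sup>2 * g q i) summable_on {1..}"
    by (rule summable_on_cong) (rule fg)
  then show "f q summable_on multi_indices"
    using summable_infsum_supported_on_image(1)[OF inj sub, of "f q"] out summable_on_cmult_right[OF g] by blast
  have "infsum (f q) multi_indices = (\<Sum>\<^sub>\<infinity>i\<in>{1..}. f q (mi_unit2 i 1))"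
    using summable_infsum_supported_on_image(2)[OF inj sub, of "f q"] out by blast
  also have "\<dots> = (\<Sum>\<^sub>\<infinity>i\<in>{1..}. (m2 \<nu>)\<^sup>2 * g q i)"
    by (rule infsum_cong) (rule fg)
  finally show "infsum (f q) multi_indices = (m2 \<nu>)\<^sup>2 * infsum (g q) {1..}"
    by (simp add: infsum_cmult_right')
qed

lemma levy_hidaI:
  assumes "1 \<le> q" "(\<lambda>\<alpha>. (b \<alpha>)\<^sup>2 * mi_fact \<alpha> * two_N (- int q) \<alpha>) summable_on multi_indices"
  shows "formal_expansion K b \<in> levy_hida K"
  using assms unfolding levy_hida_def by blast

section \<open>Weighted square summability of the Levy polynomials almost everywhere\<close>

lemma eta_measurable [measurable]: "eta \<nu> m \<in> borel_measurable borel"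
proof (induction m rule: less_induct)
  case (less m)
  have [measurable]: "eta \<nu> l \<in> borel_measurable borel" if "l \<in> {..<m}" for l
    using less that by simp
  show ?case
    by (subst eta.simps) measurable
qed

text \<open>Moving z^2 into the measure turns the integral into the squared norm of
  \<open>eta\<close> in L^2(rho) divided by itself. This is 1, or 0 when the norm vanishes, hence an
  inequality.\<close>

lemma levy_poly_square_integral_le_1:
  assumes "levy_measure \<nu>"
  shows "(\<integral>\<^sup>+ z. ennreal ((levy_poly \<nu> j z)\<^sup>2) \<partial>\<nu>) \<le> 1"
proof -
  have sets: "sets \<nu> = sets (restrict_space borel (- {0}))"
    using assms by (simp add: levy_measure_def)
  \<comment> \<open>The measure lives on the punctured line; Borel functions on the whole line
    restrict to it.\<close>
  have meas: "f \<in> borel_measurable \<nu>" if "f \<in> borel_measurable borel" for f :: "real \<Rightarrow> 'c::topological_space"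
    using measurable_restrict_space1[OF that] measurable_cong_sets[OF sets refl] by blast
  define h where "h = eta \<nu> (j - 1)"
  define I where "I = (\<integral> y. (h y)\<^sup>2 \<partial>rho \<nu>)"
  have h [measurable]: "h \<in> borel_measurable borel" by (simp add: h_def)
  have hr: "(\<lambda>y. (h y)\<^sup>2) \<in> borel_measurable (rho \<nu>)"
    unfolding rho_def using meas[of "\<lambda>y. (h y)\<^sup>2"] by simp
  have I0: "0 \<le> I" by (simp add: I_def)
  have p: "(levy_poly \<nu> j z)\<^sup>2 = (1 / I) * (z\<^sup>2 * (h z)\<^sup>2)" for z
    unfolding levy_poly_def h_def[symmetric] I_def[symmetric]
    using I0 by (simp add: power_divide power_mult_distrib)
  have "(\<integral>\<^sup>+ z. ennreal ((levy_poly \<nu> j z)\<^sup>2) \<partial>\<nu>) = ennreal (1 / I) * (\<integral>\<^sup>+ z. ennreal (z\<^sup>2 * (h z)\<^sup>2) \<partial>\<nu>)"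
    unfolding p using I0 meas[of "\<lambda>z. ennreal (z\<^sup>2 * (h z)\<^sup>2)"]
    by (subst ennreal_mult, simp, simp) (rule nn_integral_cmult, simp)
  also have "(\<integral>\<^sup>+ z. ennreal (z\<^sup>2 * (h z)\<^sup>2) \<partial>\<nu>) = (\<integral>\<^sup>+ z. ennreal ((h z)\<^sup>2) \<partial>rho \<nu>)"
    unfolding rho_def using meas[of "\<lambda>z. ennreal (z\<^sup>2)"] meas[of "\<lambda>z. ennreal ((h z)\<^sup>2)"]
    by (subst nn_integral_density) (auto simp: ennreal_mult)
  also have "ennreal (1 / I) * \<dots> \<le> 1"
  proof (cases "integrable (rho \<nu>) (\<lambda>y. (h y)\<^sup>2)")
    case True
    then have "(\<integral>\<^sup>+ z. ennreal ((h z)\<^sup>2) \<partial>rho \<nu>) = ennreal I"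
      unfolding I_def by (intro nn_integral_eq_integral) auto
    then show ?thesis using I0 by (simp flip: ennreal_mult)
  next
    case False
    \<comment> \<open>Here \<open>I\<close> takes the default value of a non-integrable function,
      and the factor \<open>1 / I\<close> is 0 as well.\<close>
    then have "I = 0" unfolding I_def by (rule not_integrable_integral_eq)
    then show ?thesis by simp
  qed
  finally show ?thesis .
qed

lemma AE_levy_poly_summable:
  assumes "levy_measure \<nu>"
  shows "AE z in \<nu>. (\<lambda>j. (levy_poly \<nu> j z)\<^sup>2 / (real j)\<^sup>2) summable_on {1..}"
proof -
  have sets: "sets \<nu> = sets (restrict_space borel (- {0}))"
    using assms by (simp add: levy_measure_def)
  have "levy_poly \<nu> j \<in> borel_measurable borel" for j
    unfolding levy_poly_def[abs_def] by measurable
  then have [measurable]: "levy_poly \<nu> j \<in> borel_measurable \<nu>" for j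
    using measurable_restrict_space1 measurable_cong_sets[OF sets refl] by blast
  \<comment> \<open>At j = 0 the division by zero gives 0, so the series may run over all natural
    numbers.\<close>
  define a where "a j z = (levy_poly \<nu> j z)\<^sup>2 / (real j)\<^sup>2" for j z
  have [measurable]: "a j \<in> borel_measurable \<nu>" for j
    unfolding a_def by measurable
  have a0: "0 \<le> a j z" for j z by (simp add: a_def)
  have int: "(\<integral>\<^sup>+ z. ennreal (a j z) \<partial>\<nu>) \<le> ennreal (1 / (real j)\<^sup>2)" for j
  proof -
    have "(\<integral>\<^sup>+ z. ennreal (a j z) \<partial>\<nu>) = ennreal (1 / (real j)\<^sup>2) * (\<integral>\<^sup>+ z. ennreal ((levy_poly \<nu> j z)\<^sup>2) \<partial>\<nu>)"
      by (subst nn_integral_cmult[symmetric]) (auto simp: a_def simp flip: ennreal_mult)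
    also have "\<dots> \<le> ennreal (1 / (real j)\<^sup>2) * 1"
      by (intro mult_left_mono levy_poly_square_integral_le_1 assms) auto
    finally show ?thesis by simp
  qed
  have "(\<integral>\<^sup>+ z. (\<Sum>j. ennreal (a j z)) \<partial>\<nu>) = (\<Sum>j. \<integral>\<^sup>+ z. ennreal (a j z) \<partial>\<nu>)"
    by (rule nn_integral_suminf) measurable
  also have "\<dots> \<le> (\<Sum>j. ennreal (1 / (real j)\<^sup>2))"
    by (intro suminf_le int) auto
  also have "\<dots> = ennreal (\<Sum>j. 1 / (real j)\<^sup>2)"
    using inverse_power_summable[of 2, where 'a = real] by (intro suminf_ennreal2) (auto simp: divide_inverse)
  also have "\<dots> < \<infinity>" by simp
  finally have "AE z in \<nu>. (\<Sum>j. ennreal (a j z)) \<noteq> \<infinity>"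
    by (intro nn_integral_PInf_AE) auto
  then show ?thesis
  proof eventually_elim
    case (elim z)
    then have "summable (\<lambda>j. a j z)"
      using a0 by (intro summable_suminf_not_top) auto
    then have "(\<lambda>j. a j z) summable_on UNIV"
      using a0 by (subst summable_on_UNIV_nonneg_real_iff) auto
    then show ?case
      unfolding a_def by (rule summable_on_subset_banach) auto
  qed
qed

theorem mainTheorem1:
  fixes \<nu> :: "real measure"
    and P :: "'w measure"
    and N :: "'w \<Rightarrow> ((real ^ 'n::finite) \<times> real) measure"
    and e :: "nat \<Rightarrow> real ^ 'n \<Rightarrow> real"
    and K :: "(nat \<Rightarrow> nat) \<Rightarrow> 'w \<Rightarrow> real"
  assumes "levy_measure \<nu>"
    and "hermite_enumeration e"
    and "poisson_random_measure P N (intensity \<nu>)"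
    and "chaos_basis P N \<nu> e K"
  shows "(\<forall>x. \<forall>q::nat. 2 \<le> q \<longrightarrow>
           (\<lambda>\<alpha>. (levy_noise_coeff \<nu> e x \<alpha>)\<^sup>2 * mi_fact \<alpha> * two_N (- int q) \<alpha>)
              summable_on multi_indices \<and>
           (\<lambda>i. (e i x)\<^sup>2 * 2 powi (- int q) * real (kappa i 1) powi (- int q))
              summable_on {1..} \<and>
           (\<Sum>\<^sub>\<infinity>\<alpha>\<in>multi_indices.
              (levy_noise_coeff \<nu> e x \<alpha>)\<^sup>2 * mi_fact \<alpha> * two_N (- int q) \<alpha>) =
           (m2 \<nu>)\<^sup>2 *
             (\<Sum>\<^sub>\<infinity>i\<in>{1..}. (e i x)\<^sup>2 * 2 powi (- int q) * real (kappa i 1) powi (- int q)))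
       \<and> (\<forall>i\<ge>1. real (kappa i 1) = 1 + (real i - 1) * real i / 2 \<and> i \<le> kappa i 1)
       \<and> (\<forall>m\<ge>1. bdd_above (range (\<lambda>t. \<bar>xi m t\<bar>)))
       \<and> (\<lambda>m. SUP t. \<bar>xi m t\<bar>) \<in> O(\<lambda>m. real m powr (-1/12))
       \<and> (\<forall>x. levy_noise K \<nu> e x \<in> levy_hida K)
       \<and> (AE z in \<nu>. \<forall>x. poisson_noise K \<nu> e x z \<in> levy_hida K)"
proof -
  define D :: real where "D = (9 ^ CARD('n))\<^sup>2"
  have e: "(e i x)\<^sup>2 \<le> D" if "1 \<le> i" for i x
    unfolding D_def by (rule hermite_enumeration_bound[OF assms(2) that])
  have summable: "(\<lambda>i. (e i x)\<^sup>2 * 2 powi (- int q) * real (kappa i 1) powi (- int q)) summable_on {1..}"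
    if "2 \<le> q" for q x
    using e that by (rule levy_noise_summable)
  have xi_sup: "(SUP t. \<bar>xi m t\<bar>) \<le> 9 * real m powr (-1/12)" "0 \<le> (SUP t. \<bar>xi m t\<bar>)"
    and bdd: "bdd_above (range (\<lambda>t. \<bar>xi m t\<bar>))" if "1 \<le> m" for m
  proof -
    \<comment> \<open>Boundedness gives the real-valued \<open>SUP\<close> its meaning as a
      supremum; its sign is then seen from the value at 0.\<close>
    show bdd: "bdd_above (range (\<lambda>t. \<bar>xi m t\<bar>))"
      using xi_bound[OF that] by (intro bdd_aboveI2)
    show "(SUP t. \<bar>xi m t\<bar>) \<le> 9 * real m powr (-1/12)"
      using xi_bound[OF that] by (intro cSUP_least) auto
    show "0 \<le> (SUP t. \<bar>xi m t\<bar>)"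
      using bdd by (rule cSUP_upper2[where x = 0]) auto
  qed
  have bigo: "(\<lambda>m. SUP t. \<bar>xi m t\<bar>) \<in> O(\<lambda>m. real m powr (-1/12))"
  proof (rule bigoI)
    show "\<forall>\<^sub>F m in sequentially. norm (SUP t. \<bar>xi m t\<bar>) \<le> 9 * norm (real m powr (-1/12))"
      using eventually_ge_at_top[of 1] by eventually_elim (use xi_sup in simp)
  qed
  have levy: "\<forall>x. levy_noise K \<nu> e x \<in> levy_hida K"
    unfolding levy_noise_def
    by (rule allI, rule levy_hidaI[of 2], simp, rule levy_noise_reindex(1), rule summable, simp)
  \<comment> \<open>The exceptional null set comes from the polynomials in \<open>z\<close> alone,
    so it serves all x at once.\<close>
  have poisson: "AE z in \<nu>. \<forall>x. poisson_noise K \<nu> e x z \<in> levy_hida K"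
    using AE_levy_poly_summable[OF assms(1)]
  proof eventually_elim
    case (elim z)
    show ?case
      unfolding poisson_noise_def
      by (intro allI levy_hidaI[of 4] poisson_noise_summable[OF e elim]) simp_all
  qed
  have "\<forall>i\<ge>1. real (kappa i 1) = 1 + (real i - 1) * real i / 2 \<and> i \<le> kappa i 1"
    using kappa_one kappa_ge(1) by blast
  moreover have "\<forall>m\<ge>1. bdd_above (range (\<lambda>t. \<bar>xi m t\<bar>))"
    using bdd by blast
  moreover have "\<forall>x. \<forall>q\<ge>2.
      (\<lambda>\<alpha>. (levy_noise_coeff \<nu> e x \<alpha>)\<^sup>2 * mi_fact \<alpha> * two_N (- int q) \<alpha>) summable_on multi_indices \<and>
      (\<lambda>i. (e i x)\<^sup>2 * 2 powi (- int q) * real (kappa i 1) powi (- int q)) summable_on {1..} \<and>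
      (\<Sum>\<^sub>\<infinity>\<alpha>\<in>multi_indices. (levy_noise_coeff \<nu> e x \<alpha>)\<^sup>2 * mi_fact \<alpha> * two_N (- int q) \<alpha>) =
      (m2 \<nu>)\<^sup>2 * (\<Sum>\<^sub>\<infinity>i\<in>{1..}. (e i x)\<^sup>2 * 2 powi (- int q) * real (kappa i 1) powi (- int q))"
    by (intro conjI allI impI levy_noise_reindex summable)
  ultimately show ?thesis
    using bigo levy poisson by (intro conjI)
qed

end
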